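(* Let $\sigma>0$, let $n\ge 3$ be an integer, $h=1/n$, and let $f:\mathbb{R}\to\mathbb{R}$ be a nonnegative convex function such that $\int^\infty\frac{1}{f(s)}\,ds<\infty$. Let $w_2,\dots,w_{n-1}$ be independent standard one-dimensional Brownian motions. Then, for every nonnegative initial datum $U^0\ge 0$ (componentwise), the solution $U=(u_1,\dots,u_n)$ of the system of stochastic differential equations $$du_i=\frac{1}{h^2}\,(u_{i+1}-2u_i+u_{i-1})\,dt+f(u_i)\,dt+\frac{\sigma}{\sqrt h}\,dw_i,\qquad 2\le i\le n-1,$$ with boundary conditions $u_1(t)=u_n(t)=0$ for all $t$ and initial condition $u_i(0)=U^0_i$ for $2\le i\le n-1$, blows up in finite (random) time $T^n$, with $$\mathbb{P}^{U^0}(T^n<\infty)=1.$$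
   Context: The condition $\int^\infty 1/f<\infty$ means that there is $a\in\mathbb{R}$ with $f>0$ on $[a,\infty)$ and $\int_a^\infty\frac{ds}{f(s)}<\infty$. Since $f$ is convex it is locally Lipschitz, so the system has a unique strong solution up to its explosion time $T^n:=\lim_{m\to\infty}\inf\{t\ge 0:\max_i|u_i(t)|\ge m\}\in(0,\infty]$. $\mathbb{P}^{U^0}$ denotes probability when the initial datum is $U^0$. This system is the space semidiscretization, by second-order finite differences on a uniform mesh of size $h=1/n$, of $u_t=u_{xx}+f(u)+\sigma\dot W$ on $(0,1)$ with homogeneous Dirichlet boundary conditions. The $w_i$ arise by (normalized) space integration of the Brownian sheet $W$ over $[ih,(i+1)h)$. *)

theory Defs
  imports "HOL-Probability.Probability"
begin

definition standard_brownian_motion :: "'a measure \<Rightarrow> (real \<Rightarrow> 'a \<Rightarrow> real) \<Rightarrow> bool" where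
  "standard_brownian_motion M B \<longleftrightarrow>
     (\<forall>t\<ge>0. B t \<in> borel_measurable M) \<and>
     (AE \<omega> in M. B 0 \<omega> = 0) \<and>
     (\<forall>s t. 0 \<le> s \<and> s < t \<longrightarrow>
        distributed M lborel (\<lambda>\<omega>. B t \<omega> - B s \<omega>) (normal_density 0 (sqrt (t - s)))) \<and>
     (\<forall>(k::nat) \<tau>. 0 \<le> \<tau> 0 \<and> (\<forall>j<k. \<tau> j < \<tau> (Suc j)) \<longrightarrow>
        prob_space.indep_vars M (\<lambda>_. borel) (\<lambda>j \<omega>. B (\<tau> (Suc j)) \<omega> - B (\<tau> j) \<omega>) {..<k}) \<and>
     (AE \<omega> in M. continuous_on {0..} (\<lambda>t. B t \<omega>))"

text \<open>Independence of whole processes, each viewed as a random path on \<open>{0..}\<close> with the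
  product sigma-algebra.\<close>

definition independent_processes ::
    "'a measure \<Rightarrow> nat set \<Rightarrow> (nat \<Rightarrow> real \<Rightarrow> 'a \<Rightarrow> real) \<Rightarrow> bool" where
  "independent_processes M I w \<longleftrightarrow>
     prob_space.indep_vars M (\<lambda>_. PiM {0..} (\<lambda>_. borel)) (\<lambda>i \<omega>. \<lambda>t\<in>{0..}. w i t \<omega>) I"

text \<open>The filtration generated by the processes \<open>w i\<close>, \<open>i \<in> I\<close>, augmented by the null sets.\<close>

definition augmented_filtration ::
    "'a measure \<Rightarrow> nat set \<Rightarrow> (nat \<Rightarrow> real \<Rightarrow> 'a \<Rightarrow> real) \<Rightarrow> real \<Rightarrow> 'a measure" where
  "augmented_filtration M I w t =
     sigma (space M)
       ({w i s -` A \<inter> space M | i s A. i \<in> I \<and> 0 \<le> s \<and> s \<le> t \<and> A \<in> sets borel} \<union> null_sets M)"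

definition convergent_reciprocal_integral :: "(real \<Rightarrow> real) \<Rightarrow> bool" where
  "convergent_reciprocal_integral f \<longleftrightarrow>
     (\<exists>a. (\<forall>s\<ge>a. 0 < f s) \<and> (\<integral>\<^sup>+ s\<in>{a..}. ennreal (1 / f s) \<partial>lborel) < \<infinity>)"

text \<open>A path \<open>u\<close> with lifetime \<open>\<zeta>\<close> is meaningful on \<open>[0, \<zeta>)\<close> only, since HOL functions are
  total; hence the restriction to times below \<open>\<zeta>\<close>. The infimum is taken in \<open>ereal\<close>, so it is
  \<open>\<infinity>\<close> if the level is never reached.\<close>

definition level_time :: "nat \<Rightarrow> ereal \<Rightarrow> (nat \<Rightarrow> real \<Rightarrow> real) \<Rightarrow> nat \<Rightarrow> ereal" where
  "level_time n \<zeta> u m =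
     Inf {ereal t | t. 0 \<le> t \<and> ereal t < \<zeta> \<and> real m \<le> (MAX i\<in>{1..n}. \<bar>u i t\<bar>)}"

definition explosion_time :: "nat \<Rightarrow> ereal \<Rightarrow> (nat \<Rightarrow> real \<Rightarrow> real) \<Rightarrow> ereal" where
  "explosion_time n \<zeta> u = lim (\<lambda>m. level_time n \<zeta> u m)"

definition drift :: "real \<Rightarrow> (real \<Rightarrow> real) \<Rightarrow> (nat \<Rightarrow> real) \<Rightarrow> nat \<Rightarrow> real" where
  "drift h f v i = 1 / h\<^sup>2 * (v (i + 1) - 2 * v i + v (i - 1)) + f (v i)"

text \<open>Strong solution \<open>U\<close> with lifetime \<open>T\<close>. As the noise coefficient is constant, the
  stochastic integral is \<open>\<sigma> / sqrt h * w i t\<close> and the equation is an integral equation for each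
  path. The condition \<open>T \<omega> = explosion_time \<dots>\<close> makes the solution maximal: it fails
  if the path stays bounded on \<open>[0, T \<omega>)\<close> with \<open>T \<omega>\<close> finite.\<close>

definition strong_solution ::
    "'a measure \<Rightarrow> nat \<Rightarrow> real \<Rightarrow> real \<Rightarrow> (real \<Rightarrow> real) \<Rightarrow> (nat \<Rightarrow> real \<Rightarrow> 'a \<Rightarrow> real) \<Rightarrow>
     (nat \<Rightarrow> real) \<Rightarrow> (nat \<Rightarrow> real \<Rightarrow> 'a \<Rightarrow> real) \<Rightarrow> ('a \<Rightarrow> ereal) \<Rightarrow> bool" where
  "strong_solution M n h \<sigma> f w U0 U T \<longleftrightarrow>
     (\<forall>t\<ge>0. {\<omega> \<in> space M. ereal t < T \<omega>} \<in> sets (augmented_filtration M {2..n-1} w t)) \<and>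
     (\<forall>t\<ge>0. \<forall>i\<in>{1..n}. (\<lambda>\<omega>. if ereal t < T \<omega> then U i t \<omega> else 0)
        \<in> borel_measurable (augmented_filtration M {2..n-1} w t)) \<and>
     (AE \<omega> in M.
        0 < T \<omega> \<and>
        T \<omega> = explosion_time n (T \<omega>) (\<lambda>i t. U i t \<omega>) \<and>
        (\<forall>i\<in>{1..n}. continuous_on {t. 0 \<le> t \<and> ereal t < T \<omega>} (\<lambda>t. U i t \<omega>)) \<and>
        (\<forall>i\<in>{2..n-1}. U i 0 \<omega> = U0 i) \<and>
        (\<forall>t. 0 \<le> t \<and> ereal t < T \<omega> \<longrightarrow>
           U 1 t \<omega> = 0 \<and> U n t \<omega> = 0 \<and>
           (\<forall>i\<in>{2..n-1}.
              U i t \<omega> = U0 i + integral {0..t} (\<lambda>s. drift h f (\<lambda>j. U j s \<omega>) i)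
                        + \<sigma> / sqrt h * w i t \<omega>)))"

end

theory Submission
  imports Defs
begin

text \<open>
  Let \<open>\<phi>\<close> be the normalized positive eigenvector of the discrete Dirichlet Laplacian, with eigenvalue
  \<open>- l\<close>. By Jensen's inequality \<open>S = \<Sum> \<phi>\<^sub>i u\<^sub>i\<close> satisfies \<open>dS \<ge> (f(S) - l S) dt + \<kappa> dB\<close> for a single standard
  Brownian motion \<open>B\<close>. If \<open>S\<close> is large at a time \<open>b\<close> and \<open>B - B(b)\<close> stays above \<open>- r\<close> on \<open>[b, b + 1]\<close>,
  then \<open>S - \<kappa> (B - B(b))\<close> dominates, up to a constant shift, a solution of \<open>x' = f(x) / 2\<close>, which explodes before time \<open>b + 1\<close>.
  To see that this happens almost surely, drop the term \<open>f(S) \<ge> 0\<close>: on \<open>[a, b]\<close>, \<open>S\<close> lies above an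
  Ornstein-Uhlenbeck process started from \<open>S(a)\<close>, whose noise part exceeds a given level with a
  probability bounded below uniformly in \<open>a < b\<close>, independently over disjoint windows. The
  contribution of \<open>S(a)\<close> is made negligible by choosing the length of the window after \<open>a\<close>, so that
  neither moment bounds on \<open>S(a)\<close> nor the Markov property are needed.
\<close>

section \<open>Growth of the nonlinearity and comparison for the scalar equation\<close>

text \<open>If \<open>f y < c * y\<close> held for arbitrarily large \<open>y\<close>, convexity
  would bound \<open>f\<close> linearly on a whole half-line and the integral of
  \<open>1 / f\<close> would diverge logarithmically; hence \<open>f\<close> eventually dominates
  \<open>c * x\<close>. A convex function that has risen above an earlier value is increasing from
  there on. Later \<open>c\<close> is twice the eigenvalue, so that half of \<open>f\<close> absorbs
  the linear damping, and 1/2 is the amount by which the integral of \<open>1 / f\<close> grows in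
  unit time along x' = f(x) / 2.\<close>

lemma ex_explosion_threshold:
  fixes f :: "real \<Rightarrow> real"
  assumes convex: "convex_on UNIV f" and nonneg: "\<And>x. 0 \<le> f x"
    and conv: "convergent_reciprocal_integral f" and c: "0 < c"
  obtains x0 where "0 < x0" "\<And>x. x0 \<le> x \<Longrightarrow> 0 < f x" "\<And>x. x0 \<le> x \<Longrightarrow> c * x \<le> f x"
    "\<And>x y. x0 \<le> x \<Longrightarrow> x \<le> y \<Longrightarrow> f x \<le> f y"
    "\<And>y. x0 \<le> y \<Longrightarrow> integral {x0..y} (\<lambda>s. 1 / f s) < 1/2"
proof -
  have cont: "continuous_on A f" for A
    using convex_on_continuous[OF open_UNIV convex] continuous_on_subset by blast
  have chord: "f x \<le> f u + (x - u) / (v - u) * (f v - f u)" if "u \<le> x" "x \<le> v" "u < v" for u x v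
  proof -
    define t where "t = (x - u) / (v - u)"
    have t: "0 \<le> t" "t \<le> 1" using that by (auto simp: t_def)
    have "t * (v - u) = x - u" using that by (simp add: t_def)
    then have "x = (1 - t) * u + t * v" by (simp add: algebra_simps)
    then have "f x \<le> (1 - t) * f u + t * f v"
      using convex_onD[OF convex, of t u v] t by simp
    also have "\<dots> = f u + t * (f v - f u)" by (simp add: algebra_simps)
    finally show ?thesis by (simp add: t_def)
  qed
  obtain a0 where a0: "\<And>s. s \<ge> a0 \<Longrightarrow> 0 < f s"
    and fin0: "(\<integral>\<^sup>+ s\<in>{a0..}. ennreal (1 / f s) \<partial>lborel) < \<infinity>"
    using conv unfolding convergent_reciprocal_integral_def by blast
  \<comment> \<open>The lower bound 1 allows constants to be absorbed into multiples of
    \<open>x\<close> when \<open>f x \<le> C * x\<close> is derived.\<close>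
  define a where "a = max a0 1"
  have a: "1 \<le> a" "\<And>s. s \<ge> a \<Longrightarrow> 0 < f s" using a0 by (auto simp: a_def)
  define I where "I = enn2real (\<integral>\<^sup>+ s\<in>{a0..}. ennreal (1 / f s) \<partial>lborel)"
  have intg: "(\<lambda>s. 1 / f s) integrable_on {x..y}" if "a \<le> x" for x y
    using that a(2) by (intro integrable_continuous_real continuous_intros cont)
      (metis atLeastAtMost_iff less_irrefl order_trans)
  have bound: "integral {a..y} (\<lambda>s. 1 / f s) \<le> I" for y
  proof -
    have "ennreal (integral {a..y} (\<lambda>s. 1 / f s)) = (\<integral>\<^sup>+ x. indicator {a..y} x * ennreal (1 / f x) \<partial>lborel)"
      using nonneg nn_integral_has_integral_lebesgue[OF _ integrable_integral[OF intg[of a y]], symmetric]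
      by (auto intro!: nn_integral_cong simp: indicator_def)
    also have "\<dots> \<le> (\<integral>\<^sup>+ s\<in>{a0..}. ennreal (1 / f s) \<partial>lborel)"
      by (intro nn_integral_mono) (auto simp: indicator_def a_def)
    also have "\<dots> = ennreal I" using fin0 by (simp add: I_def)
    finally show ?thesis by (simp add: I_def)
  qed
  have "\<exists>x1. \<forall>x\<ge>x1. c * x \<le> f x"
  proof (rule ccontr)
    assume neg: "\<not> ?thesis"
    define C where "C = f a + 2 * c"
    have C: "C > 0" using a(2)[of a] c by (simp add: C_def)
    have lin: "f x \<le> C * x" if x: "a \<le> x" for x
    proof -
      \<comment> \<open>Beyond \<open>2 * a\<close> one has \<open>y \<le> 2 * (y - a)\<close>, so
        the chord from \<open>a\<close> to \<open>y\<close> has slope at most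
        \<open>2 * c\<close>.\<close>
      obtain y where y: "y \<ge> max x (2 * a) + 1" "f y < c * y" using neg by (meson not_le)
      have ya: "y > a" "x \<le> y" "y \<ge> 2 * a" using y a by auto
      have "f x \<le> f a + (x - a) / (y - a) * (f y - f a)" using chord x ya by simp
      also have "\<dots> \<le> f a + (x - a) / (y - a) * (2 * c * (y - a))"
      proof -
        have "c * (2 * a) \<le> c * y" using ya c by (intro mult_left_mono) auto
        then have "f y - f a \<le> 2 * c * (y - a)" using y nonneg[of a] by (simp add: algebra_simps)
        then show ?thesis using ya x by (intro add_left_mono mult_left_mono) auto
      qed
      also have "\<dots> = f a + 2 * c * (x - a)" using ya by (simp add: field_simps)
      also have "\<dots> \<le> f a * x + 2 * c * x"
        using mult_left_mono[of 1 x "f a"] nonneg[of a] x a(1) mult_nonneg_nonneg[OF order.trans[OF zero_le_one a(1)] less_imp_le[OF c]]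
        by (simp add: algebra_simps)
      finally show ?thesis by (simp add: C_def algebra_simps)
    qed
    \<comment> \<open>Chosen so that the integral of \<open>1 / (C * s)\<close> over
      \<open>{a..y}\<close> equals \<open>\<bar>I\<bar> + 1\<close>, which exceeds the bound
      \<open>I\<close>.\<close>
    define y where "y = a * exp (C * (\<bar>I\<bar> + 1))"
    have ya: "a \<le> y" using a C by (simp add: y_def)
    have "((\<lambda>s. 1 / (C * s)) has_integral (ln y / C - ln a / C)) {a..y}"
      using a(1) C ya
      by (intro fundamental_theorem_of_calculus)
        (auto intro!: derivative_eq_intros simp flip: has_real_derivative_iff_has_vector_derivative)
    then have "ln y / C - ln a / C \<le> integral {a..y} (\<lambda>s. 1 / f s)"
      using a intg[of a y] lin nonneg C
      by (intro has_integral_le[OF _ integrable_integral]) (auto intro!: divide_left_mono)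
    moreover have "ln y / C - ln a / C = \<bar>I\<bar> + 1"
      using a(1) C by (simp add: y_def ln_mult field_simps)
    ultimately show False using bound[of y] by linarith
  qed
  then obtain x1 where x1: "\<And>x. x1 \<le> x \<Longrightarrow> c * x \<le> f x" by blast
  \<comment> \<open>The last entry of the maximum puts \<open>c * x2\<close>, and with it
    \<open>f x2\<close>, above \<open>f a\<close>.\<close>
  define x2 where "x2 = max (max x1 (a + 1)) ((f a + 1) / c)"
  have "f a + 1 \<le> c * x2" using c by (simp add: x2_def max_def field_simps)
  moreover have x2: "x1 \<le> x2" "a < x2" by (auto simp: x2_def)
  ultimately have fx2: "f a < f x2" using x1[of x2] by linarith
  have fa_less: "f a < f x" if "x2 \<le> x" for x
  proof -
    have "0 < (x2 - a) / (x - a) * (f x - f a)"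
      using chord[of a x2 x] that x2 fx2 by auto
    then show ?thesis using that x2 by (simp add: zero_less_mult_iff zero_less_divide_iff)
  qed
  have mono: "f x \<le> f y" if "x2 \<le> x" "x \<le> y" for x y
  proof -
    have "f x \<le> f a + (x - a) / (y - a) * (f y - f a)" using chord[of a x y] that x2 by auto
    also have "\<dots> \<le> f a + 1 * (f y - f a)"
      using that x2 fa_less[of y] by (intro add_left_mono mult_right_mono) auto
    finally show ?thesis by simp
  qed
  define J where "J = (\<lambda>y. integral {a..y} (\<lambda>s. 1 / f s))"
  have bdd: "bdd_above (J ` {x2..})" using bound by (auto simp: J_def intro!: bdd_aboveI2)
  \<comment> \<open>Since \<open>J\<close> is bounded above, some \<open>x0\<close> leaves less than
    1/2 to be gained up to the supremum.\<close>
  obtain x0 where x0: "x2 \<le> x0" "Sup (J ` {x2..}) - 1/2 < J x0"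
    using less_cSupD[of "J ` {x2..}" "Sup (J ` {x2..}) - 1/2"] by auto
  have "integral {x0..y} (\<lambda>s. 1 / f s) < 1/2" if y: "x0 \<le> y" for y
  proof -
    have "J x0 + integral {x0..y} (\<lambda>s. 1 / f s) = J y"
      unfolding J_def using x0 x2 y intg[of a y] by (intro Henstock_Kurzweil_Integration.integral_combine) auto
    moreover have "J y \<le> Sup (J ` {x2..})" using bdd x0 y by (intro cSup_upper) auto
    ultimately show ?thesis using x0 by linarith
  qed
  then show ?thesis using that[of x0] x0 x1 x2 a mono by (smt (verit))
qed

text \<open>Here \<open>S\<close> and \<open>F\<close> stand for the weighted means of the
  \<open>u i\<close> and of the \<open>f (u i)\<close>, so \<open>FS\<close> is Jensen's inequality.
  Replacing the noise by its lower bound \<open>- \<rho>\<close> leaves a differentiable function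
  \<open>E\<close> below \<open>S\<close>. In \<open>start\<close>, \<open>\<rho>\<close> pays for
  the noise and \<open>l * x0\<close> for the damping during one unit of time, which keeps
  \<open>E\<close> above \<open>x0\<close>. There \<open>f\<close> is increasing and half of it
  beats the damping, so \<open>E\<close> grows at least as fast as x' = f(x) / 2 and would have to
  explode.\<close>

lemma no_solution_past_threshold:
  fixes f S F N :: "real \<Rightarrow> real"
  assumes contf: "continuous_on UNIV f" and nonneg: "\<And>x. 0 \<le> f x"
    and x0: "0 < x0" "\<And>x. x0 \<le> x \<Longrightarrow> 0 < f x" "\<And>x. x0 \<le> x \<Longrightarrow> 2 * l * x \<le> f x"
      "\<And>x y. x0 \<le> x \<Longrightarrow> x \<le> y \<Longrightarrow> f x \<le> f y"
      "\<And>y. x0 \<le> y \<Longrightarrow> integral {x0..y} (\<lambda>s. 1 / f s) < 1/2"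
    and l: "0 \<le> l"
    and S: "continuous_on {b..b+1} S" and F: "continuous_on {b..b+1} F"
    and eq: "\<And>t. t \<in> {b..b+1} \<Longrightarrow> S t = S b + integral {b..t} (\<lambda>s. F s - l * S s) + (N t - N b)"
    and FS: "\<And>t. t \<in> {b..b+1} \<Longrightarrow> f (S t) \<le> F t"
    and N: "\<And>t. t \<in> {b..b+1} \<Longrightarrow> - \<rho> \<le> N t - N b"
    and start: "x0 + l * x0 + \<rho> \<le> S b"
  shows False
proof -
  define E where "E = (\<lambda>t. S b - \<rho> + integral {b..t} (\<lambda>s. F s - l * S s))"
  have cont: "continuous_on {b..b+1} (\<lambda>s. F s - l * S s)" by (intro continuous_intros S F)
  have E': "(E has_real_derivative F t - l * S t) (at t within {b..b+1})" if "t \<in> {b..b+1}" for t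
    unfolding E_def using integral_has_real_derivative[OF cont that]
    by (auto intro!: derivative_eq_intros)
  have ES: "E t \<le> S t" if "t \<in> {b..b+1}" for t
    using eq[OF that] N[OF that] by (simp add: E_def)
  have drift: "F t - l * S t \<ge> - (l * x0)" "S t \<ge> x0 \<Longrightarrow> F t - l * S t \<ge> f (S t) / 2"
    if "t \<in> {b..b+1}" for t
  proof -
    show 2: "F t - l * S t \<ge> f (S t) / 2" if "S t \<ge> x0"
      using x0(3)[OF that] FS[OF \<open>t \<in> _\<close>] by simp
    show "F t - l * S t \<ge> - (l * x0)"
    proof (cases "S t \<ge> x0")
      case True
      then show ?thesis using 2 nonneg[of "S t"] l x0(1) mult_nonneg_nonneg[of l x0] by linarith
    next
      case False
      then have "l * S t \<le> l * x0" using l by (intro mult_left_mono) auto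
      then show ?thesis using FS[OF that] nonneg[of "S t"] by linarith
    qed
  qed
  \<comment> \<open>The drift is at least \<open>- l x0\<close> everywhere, so \<open>E\<close> cannot fall below \<open>x0\<close> within unit time.\<close>
  have Ex0: "x0 \<le> E t" if t: "t \<in> {b..b+1}" for t
  proof -
    have "(\<lambda>t. E t + l * x0 * (t - b)) b \<le> (\<lambda>t. E t + l * x0 * (t - b)) t"
    proof (rule DERIV_nonneg_imp_increasing_open[of b t "\<lambda>t. E t + l * x0 * (t - b)"])
      show "continuous_on {b..t} (\<lambda>t. E t + l * x0 * (t - b))"
        using E' t by (intro continuous_intros continuous_on_subset[OF DERIV_continuous_on[of "{b..b+1}" E]]) auto
      fix s assume s: "b < s" "s < t"
      then have "(E has_real_derivative F s - l * S s) (at s)"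
        using E'[of s] t at_within_interior[of s "{b..b+1}"] by auto
      then show "\<exists>y. ((\<lambda>t. E t + l * x0 * (t - b)) has_real_derivative y) (at s) \<and> 0 \<le> y"
        using drift(1)[of s] s t
        by (intro exI[of _ "F s - l * S s + l * x0"]) (auto intro!: derivative_eq_intros)
    qed (use t in auto)
    moreover have "l * x0 * (t - b) \<le> l * x0 * 1" using t l x0(1) by (intro mult_left_mono) auto
    moreover have "E b \<ge> x0 + l * x0" using start by (simp add: E_def)
    ultimately show ?thesis by simp
  qed
  \<comment> \<open>\<open>P y\<close> is the time that x' = f(x) takes from \<open>x0\<close> to
    \<open>y\<close>. Along \<open>E\<close> it grows at rate at least 1/2, yet it always stays
    below 1/2.\<close>
  define P where "P = (\<lambda>y. integral {x0..y} (\<lambda>s. 1 / f s))"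
  have contE: "continuous_on {b..b+1} E" using E' by (intro DERIV_continuous_on)
  have P': "(P has_real_derivative 1 / f y) (at y within {x0..})" if "x0 \<le> y" for y
  proof -
    have "continuous_on {x0..y+1} (\<lambda>s. 1 / f s)"
      using x0(2) by (intro continuous_intros continuous_on_subset[OF contf]) force+
    from integral_has_real_derivative[OF this, of y] that
    have "(P has_real_derivative 1 / f y) (at y within {x0..y+1})" by (simp add: P_def)
    moreover have "at y within {x0..y+1} = at y within {x0..}"
      by (rule at_within_nhd[of _ "{..<y+1}"]) auto
    ultimately show ?thesis by simp
  qed
  have PE': "((\<lambda>t. P (E t)) has_real_derivative (F t - l * S t) / f (E t)) (at t within {b..b+1})"
    if "t \<in> {b..b+1}" for t
  proof -
    have "(P has_real_derivative 1 / f (E t)) (at (E t) within E ` {b..b+1})"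
      using P'[OF Ex0[OF that]] Ex0 by (auto intro: DERIV_subset)
    from DERIV_image_chain[OF this E'[OF that]] show ?thesis by (simp add: o_def)
  qed
  have "(\<lambda>t. P (E t) - t / 2) b \<le> (\<lambda>t. P (E t) - t / 2) (b + 1)"
  proof (rule DERIV_nonneg_imp_increasing_open[of b "b + 1" "\<lambda>t. P (E t) - t / 2"])
    show "continuous_on {b..b+1} (\<lambda>t. P (E t) - t / 2)"
      using DERIV_continuous_on[OF PE'] by (intro continuous_intros) auto
    fix s assume s: "b < s" "s < b + 1"
    then have d: "((\<lambda>t. P (E t)) has_real_derivative (F s - l * S s) / f (E s)) (at s)"
      using PE'[of s] at_within_interior[of s "{b..b+1}"] by auto
    have "f (E s) / 2 \<le> F s - l * S s"
      using drift(2)[of s] x0(4)[of "E s" "S s"] Ex0[of s] ES[of s] s by auto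
    then have "1 / 2 \<le> (F s - l * S s) / f (E s)"
      using x0(2)[OF Ex0[of s]] s by (simp add: field_simps)
    with d show "\<exists>y. ((\<lambda>t. P (E t) - t / 2) has_real_derivative y) (at s) \<and> 0 \<le> y"
      by (intro exI[of _ "(F s - l * S s) / f (E s) - 1 / 2"]) (auto intro!: derivative_eq_intros)
  qed auto
  moreover have "P (E (b + 1)) < 1 / 2" using x0(5) Ex0[of "b+1"] by (simp add: P_def)
  \<comment> \<open>\<open>integral\<close> is 0 for a function that is not integrable, so the sign
    is right in either case.\<close>
  moreover have "P (E b) \<ge> 0" unfolding P_def
    by (cases "(\<lambda>s. 1 / f s) integrable_on {x0..E b}")
      (auto intro!: Henstock_Kurzweil_Integration.integral_nonneg simp: not_integrable_integral nonneg)
  ultimately show False by (simp add: field_simps)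
qed

text \<open>The noise-free part \<open>D\<close> satisfies \<open>S \<le> D + e\<close>, so its
  drift is at least \<open>- l * (D + e)\<close>, and the integrating factor shows that
  \<open>D + e\<close> decays at rate at most \<open>l\<close>. The same shift \<open>e\<close>
  stands on both sides: the estimate can be iterated over many cells in terms of
  \<open>S + e\<close>, and the oscillation error does not accumulate.\<close>

lemma linear_decay_cell:
  fixes S F N :: "real \<Rightarrow> real"
  assumes "s \<le> t" and S: "continuous_on {s..t} S" and F: "continuous_on {s..t} F"
    and eq: "\<And>x. x \<in> {s..t} \<Longrightarrow> S x = S s + integral {s..x} (\<lambda>y. F y - l * S y) + (N x - N s)"
    and F0: "\<And>x. x \<in> {s..t} \<Longrightarrow> 0 \<le> F x" and l: "0 \<le> l"
    and N: "\<And>x. x \<in> {s..t} \<Longrightarrow> N x - N s \<le> e"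
  shows "exp (- l * (t - s)) * (S s + e) + (N t - N s) \<le> S t + e"
proof -
  define D where "D = (\<lambda>x. S s + integral {s..x} (\<lambda>y. F y - l * S y))"
  have cont: "continuous_on {s..t} (\<lambda>y. F y - l * S y)" by (intro continuous_intros S F)
  have D': "(D has_real_derivative F x - l * S x) (at x within {s..t})" if "x \<in> {s..t}" for x
    unfolding D_def using integral_has_real_derivative[OF cont that]
    by (auto intro!: derivative_eq_intros)
  have "(\<lambda>x. exp (l * (x - s)) * (D x + e)) s \<le> (\<lambda>x. exp (l * (x - s)) * (D x + e)) t"
  proof (rule DERIV_nonneg_imp_increasing_open[OF \<open>s \<le> t\<close>])
    show "continuous_on {s..t} (\<lambda>x. exp (l * (x - s)) * (D x + e))"
      by (intro continuous_intros DERIV_continuous_on[OF D'])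
    fix x assume x: "s < x" "x < t"
    then have d: "(D has_real_derivative F x - l * S x) (at x)"
      using D'[of x] at_within_interior[of x "{s..t}"] by auto
    have "S x - D x \<le> e" using eq[of x] N[of x] x by (simp add: D_def)
    then have "l * (S x - D x) \<le> l * e" using l by (rule mult_left_mono)
    then have nn: "0 \<le> F x - l * S x + l * (D x + e)"
      using F0[of x] x by (simp add: algebra_simps)
    have "((\<lambda>x. exp (l * (x - s)) * (D x + e)) has_real_derivative
        exp (l * (x - s)) * (F x - l * S x + l * (D x + e))) (at x)"
      using d by (auto intro!: derivative_eq_intros simp: algebra_simps)
    with nn show "\<exists>y. ((\<lambda>x. exp (l * (x - s)) * (D x + e)) has_real_derivative y) (at x) \<and> 0 \<le> y"
      by (meson exp_ge_zero mult_nonneg_nonneg)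
  qed
  then have "S s + e \<le> exp (l * (t - s)) * (D t + e)" by (simp add: D_def)
  then have "exp (- l * (t - s)) * (S s + e) \<le> exp (- l * (t - s)) * (exp (l * (t - s)) * (D t + e))"
    by (intro mult_left_mono) auto
  also have "\<dots> = D t + e" by (simp add: exp_minus)
  finally show ?thesis using eq[of t] \<open>s \<le> t\<close> by (simp add: D_def)
qed

text \<open>Discrete variation of constants, applied with one step per mesh cell and
  \<open>q = exp (- l / n)\<close>.\<close>

lemma linear_recursion_lower_bound:
  fixes V X :: "nat \<Rightarrow> real"
  assumes "\<And>j. j < m \<Longrightarrow> q * V j + X j \<le> V (Suc j)" "0 \<le> q"
  shows "q ^ m * V 0 + (\<Sum>j<m. q ^ (m - 1 - j) * X j) \<le> V m"
  using assms(1)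
proof (induction m)
  case (Suc m)
  have "q * (q ^ m * V 0 + (\<Sum>j<m. q ^ (m - 1 - j) * X j)) \<le> q * V m"
    using Suc assms(2) by (intro mult_left_mono) auto
  moreover have "q * (\<Sum>j<m. q ^ (m - 1 - j) * X j) = (\<Sum>j<m. q ^ (m - j) * X j)"
    unfolding sum_distrib_left
    by (intro sum.cong refl) (simp add: mult.assoc[symmetric] Suc_diff_Suc flip: power_Suc)
  ultimately show ?case using Suc.prems[of m] by (simp add: algebra_simps)
qed simp

text \<open>
  The first sum discretizes the Ornstein-Uhlenbeck integral of \<open>exp (- l (a + L - s)) dB\<^sub>s\<close> over
  \<open>[a, a + L]\<close> with mesh \<open>1 / n\<close>; the partial sums are the increments of \<open>B\<close> over \<open>[a + L, a + L + 1]\<close>.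
\<close>

definition high_window :: "real \<Rightarrow> real \<Rightarrow> real \<Rightarrow> nat \<Rightarrow> nat \<Rightarrow> nat \<Rightarrow> (nat \<Rightarrow> real) \<Rightarrow> bool" where
  "high_window l R r a L n x \<longleftrightarrow>
     R \<le> (\<Sum>j<L * n. exp (- l / real n) ^ (L * n - 1 - j) * x (a * n + j)) \<and>
     (\<forall>m\<le>n. - r \<le> (\<Sum>j<m. x ((a + L) * n + j)))"

section \<open>Independence of blocks and linear combinations of Brownian motions\<close>

context prob_space begin

text \<open>Independence across \<open>i\<close> comes from the whole processes \<open>Y i\<close>,
  independence across \<open>j\<close> holds within each process. For fixed \<open>i\<close> the
  events over all \<open>j\<close> together form one event about \<open>Y i\<close>, so the joint
  probability factors first over \<open>i\<close> and then over \<open>j\<close>.\<close>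

lemma indep_vars_pairs:
  fixes X :: "'i \<Rightarrow> 'j \<Rightarrow> 'a \<Rightarrow> 'b"
  assumes fin: "finite I" "finite J"
    and Y: "indep_vars N Y I"
    and g: "\<And>i j. i \<in> I \<Longrightarrow> j \<in> J \<Longrightarrow> g i j \<in> measurable (N i) (L j)"
    and X: "\<And>i j \<omega>. i \<in> I \<Longrightarrow> j \<in> J \<Longrightarrow> \<omega> \<in> space M \<Longrightarrow> X i j \<omega> = g i j (Y i \<omega>)"
    and ind: "\<And>i. i \<in> I \<Longrightarrow> indep_vars L (X i) J"
  shows "indep_vars (\<lambda>(i, j). L j) (\<lambda>(i, j). X i j) (I \<times> J)"
proof (cases "I = {} \<or> J = {}")
  case True
  then show ?thesis by (auto simp: indep_vars_def2 indep_sets_def)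
next
  case False
  have rv: "random_variable (L j) (X i j)" if "i \<in> I" "j \<in> J" for i j
    using ind that by (auto simp: indep_vars_def2)
  have rvY: "random_variable (N i) (Y i)" if "i \<in> I" for i
    using Y that by (auto simp: indep_vars_def2)
  have "indep_sets (\<lambda>p. {(case p of (i, j) \<Rightarrow> X i j) -` A \<inter> space M |A.
      A \<in> sets (case p of (i, j) \<Rightarrow> L j)}) (I \<times> J)"
  proof (subst indep_sets_finite)
    show "I \<times> J \<noteq> {}" "finite (I \<times> J)" using False fin by auto
  next
    fix p assume p: "p \<in> I \<times> J"
    show "{(case p of (i, j) \<Rightarrow> X i j) -` A \<inter> space M |A. A \<in> sets (case p of (i, j) \<Rightarrow> L j)} \<subseteq> events"
      using p rv by (auto intro: measurable_sets)
    show "space M \<in> {(case p of (i, j) \<Rightarrow> X i j) -` A \<inter> space M |A. A \<in> sets (case p of (i, j) \<Rightarrow> L j)}"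
      using p rv[THEN measurable_space]
      by (auto intro!: exI[of _ "space (case p of (i, j) \<Rightarrow> L j)"])
  next
    show "\<forall>A\<in>Pi (I \<times> J) (\<lambda>p. {(case p of (i, j) \<Rightarrow> X i j) -` A \<inter> space M |A.
        A \<in> sets (case p of (i, j) \<Rightarrow> L j)}).
      prob (\<Inter>p\<in>I \<times> J. A p) = (\<Prod>p\<in>I \<times> J. prob (A p))"
    proof
      fix A assume "A \<in> Pi (I \<times> J) (\<lambda>p. {(case p of (i, j) \<Rightarrow> X i j) -` A \<inter> space M |A.
        A \<in> sets (case p of (i, j) \<Rightarrow> L j)})"
      then have "\<forall>p\<in>I \<times> J. \<exists>B. B \<in> sets (L (snd p)) \<and> A p = X (fst p) (snd p) -` B \<inter> space M"
        by (fastforce simp: Pi_iff)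
      then obtain B where B: "\<And>i j. i \<in> I \<Longrightarrow> j \<in> J \<Longrightarrow> B (i, j) \<in> sets (L j)"
        "\<And>i j. i \<in> I \<Longrightarrow> j \<in> J \<Longrightarrow> A (i, j) = X i j -` B (i, j) \<inter> space M"
        by (metis (no_types, lifting) SigmaI fst_conv snd_conv)
      define C where "C i = {y \<in> space (N i). \<forall>j\<in>J. g i j y \<in> B (i, j)}" for i
      have C: "C i \<in> sets (N i)" if "i \<in> I" for i
        unfolding C_def
      proof (intro sets.sets_Collect_finite_All fin)
        fix j assume "j \<in> J"
        then show "{y \<in> space (N i). g i j y \<in> B (i, j)} \<in> sets (N i)"
          using measurable_sets[OF g B(1)] that by (simp add: vimage_def Int_def conj_commute)
      qed
      have Aeq: "(\<Inter>j\<in>J. A (i, j)) = Y i -` C i \<inter> space M" if "i \<in> I" for i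
        using False that measurable_space[OF rvY[OF that]] by (auto simp: B(2) C_def X)
      have "prob (\<Inter>p\<in>I \<times> J. A p) = prob (\<Inter>i\<in>I. Y i -` C i \<inter> space M)"
        by (rule arg_cong[where f = prob]) (use False in \<open>force simp flip: Aeq\<close>)
      also have "\<dots> = (\<Prod>i\<in>I. prob (Y i -` C i \<inter> space M))"
        using False fin C by (intro indep_varsD_finite[OF Y]) auto
      also have "\<dots> = (\<Prod>i\<in>I. \<Prod>j\<in>J. prob (A (i, j)))"
      proof (intro prod.cong refl)
        fix i assume i: "i \<in> I"
        have "prob (\<Inter>j\<in>J. X i j -` B (i, j) \<inter> space M) = (\<Prod>j\<in>J. prob (X i j -` B (i, j) \<inter> space M))"
          using False fin B(1) i by (intro indep_varsD_finite[OF ind]) auto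
        then show "prob (Y i -` C i \<inter> space M) = (\<Prod>j\<in>J. prob (A (i, j)))"
          using i B(2) by (simp flip: Aeq)
      qed
      also have "\<dots> = (\<Prod>p\<in>I \<times> J. prob (A p))" by (simp add: prod.cartesian_product)
      finally show "prob (\<Inter>p\<in>I \<times> J. A p) = (\<Prod>p\<in>I \<times> J. prob (A p))" .
    qed
  qed
  then show ?thesis using rv by (auto simp: indep_vars_def2)
qed

text \<open>Evaluating \<open>Q i\<close> at the restriction to \<open>K i\<close> expresses that it
  depends on the coordinates in that block only; disjoint blocks then give independent
  events.\<close>

lemma prob_indep_blocks:
  assumes X: "indep_vars (\<lambda>_. borel) X J" and fin: "finite I"
    and K: "\<And>i. i \<in> I \<Longrightarrow> K i \<subseteq> J" "disjoint_family_on K I"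
    and Q: "\<And>i. i \<in> I \<Longrightarrow> Measurable.pred (PiM (K i) (\<lambda>_. borel)) (Q i)"
  shows "prob {\<omega>\<in>space M. \<forall>i\<in>I. Q i (\<lambda>j\<in>K i. X j \<omega>)}
    = (\<Prod>i\<in>I. prob {\<omega>\<in>space M. Q i (\<lambda>j\<in>K i. X j \<omega>)})"
proof (cases "I = {}")
  case True
  then show ?thesis by (simp add: prob_space)
next
  case False
  have "indep_events (\<lambda>i. {\<omega>\<in>space M. Q i (\<lambda>j\<in>K i. X j \<omega>)}) I"
    using indep_eventsI_indep_vars[OF indep_vars_restrict[OF X K]] Q
    by (simp add: pred_def)
  then have "prob (\<Inter>i\<in>I. {\<omega>\<in>space M. Q i (\<lambda>j\<in>K i. X j \<omega>)})
      = (\<Prod>i\<in>I. prob {\<omega>\<in>space M. Q i (\<lambda>j\<in>K i. X j \<omega>)})"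
    using False fin by (auto simp: indep_events_def)
  also have "(\<Inter>i\<in>I. {\<omega>\<in>space M. Q i (\<lambda>j\<in>K i. X j \<omega>)})
      = {\<omega>\<in>space M. \<forall>i\<in>I. Q i (\<lambda>j\<in>K i. X j \<omega>)}"
    using False by auto
  finally show ?thesis .
qed

text \<open>Increments of independent Brownian motions are independent Gaussians, so their variances
  add; the weights form a unit vector, which keeps the variance \<open>t - s\<close>.\<close>

lemma standard_brownian_motion_sum:
  assumes fin: "finite I" "I \<noteq> {}" and ind: "independent_processes M I w"
    and bm: "\<And>i. i \<in> I \<Longrightarrow> standard_brownian_motion M (w i)"
    and c: "\<And>i. i \<in> I \<Longrightarrow> 0 < c i" "(\<Sum>i\<in>I. (c i)\<^sup>2) = 1"
  shows "standard_brownian_motion M (\<lambda>t \<omega>. \<Sum>i\<in>I. c i * w i t \<omega>)"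
  unfolding standard_brownian_motion_def
proof (intro conjI allI impI)
  have meas: "w i t \<in> borel_measurable M" if "i \<in> I" "0 \<le> t" for i t
    using bm that by (auto simp: standard_brownian_motion_def)
  fix t :: real assume "0 \<le> t"
  then show "(\<lambda>\<omega>. \<Sum>i\<in>I. c i * w i t \<omega>) \<in> borel_measurable M"
    using meas by (intro borel_measurable_sum borel_measurable_times) auto
next
  have "AE \<omega> in M. \<forall>i\<in>I. w i 0 \<omega> = 0"
    using bm fin by (simp add: AE_finite_all standard_brownian_motion_def)
  then show "AE \<omega> in M. (\<Sum>i\<in>I. c i * w i 0 \<omega>) = 0" by eventually_elim simp
next
  have "AE \<omega> in M. \<forall>i\<in>I. continuous_on {0..} (\<lambda>t. w i t \<omega>)"
    using bm fin by (simp add: AE_finite_all standard_brownian_motion_def)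
  then show "AE \<omega> in M. continuous_on {0..} (\<lambda>t. \<Sum>i\<in>I. c i * w i t \<omega>)"
    by eventually_elim (auto intro!: continuous_intros)
next
  have Y: "indep_vars (\<lambda>_. PiM {0..} (\<lambda>_. borel)) (\<lambda>i \<omega>. \<lambda>t\<in>{0..}. w i t \<omega>) I"
    using ind by (simp add: independent_processes_def)
  {
    fix s t :: real assume st: "0 \<le> s \<and> s < t"
    have d: "distributed M lborel (\<lambda>\<omega>. c i * (w i t \<omega> - w i s \<omega>)) (normal_density 0 (c i * sqrt (t - s)))"
      if "i \<in> I" for i
    proof -
      have "distributed M lborel (\<lambda>\<omega>. w i t \<omega> - w i s \<omega>) (normal_density 0 (sqrt (t - s)))"
        using bm[OF that] st by (auto simp: standard_brownian_motion_def)
      from normal_density_affine[OF this, of "c i" 0] st c(1)[OF that] show ?thesis by simp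
    qed
    have "indep_vars (\<lambda>_. borel) (\<lambda>i \<omega>. c i * (w i t \<omega> - w i s \<omega>)) I"
    proof -
      have "indep_vars (\<lambda>_. borel) (\<lambda>i x. (\<lambda>x. c i * (x t - x s)) (\<lambda>t\<in>{0..}. w i t x)) I"
        using st by (intro indep_vars_compose2[OF Y] borel_measurable_times borel_measurable_diff
          measurable_component_singleton) auto
      then show ?thesis using st by simp
    qed
    from sum_indep_normal[OF fin this _ d] c(1) st
    have "distributed M lborel (\<lambda>\<omega>. \<Sum>i\<in>I. c i * (w i t \<omega> - w i s \<omega>))
      (normal_density 0 (sqrt (\<Sum>i\<in>I. (c i * sqrt (t - s))\<^sup>2)))" by simp
    moreover have "(\<Sum>i\<in>I. (c i * sqrt (t - s))\<^sup>2) = t - s"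
      using c(2) st by (simp add: power_mult_distrib flip: sum_distrib_right)
    ultimately show "distributed M lborel (\<lambda>\<omega>. (\<Sum>i\<in>I. c i * w i t \<omega>) - (\<Sum>i\<in>I. c i * w i s \<omega>))
      (normal_density 0 (sqrt (t - s)))"
      by (simp add: right_diff_distrib sum_subtractf)
  }
  fix k :: nat and \<tau> :: "nat \<Rightarrow> real"
  assume \<tau>: "0 \<le> \<tau> 0 \<and> (\<forall>j<k. \<tau> j < \<tau> (Suc j))"
  have \<tau>0: "0 \<le> \<tau> j" if "j \<le> k" for j
    using that
  proof (induction j)
    case (Suc j)
    then have "\<tau> j < \<tau> (Suc j)" using \<tau> by auto
    with Suc show ?case by auto
  qed (use \<tau> in auto)
  have "indep_vars (\<lambda>(i, j). borel) (\<lambda>(i, j) \<omega>. w i (\<tau> (Suc j)) \<omega> - w i (\<tau> j) \<omega>) (I \<times> {..<k})"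
    (is "indep_vars _ ?W _")
    by (rule indep_vars_pairs[where L = "\<lambda>_. borel" and X = "\<lambda>i j \<omega>. w i (\<tau> (Suc j)) \<omega> - w i (\<tau> j) \<omega>"
          and g = "\<lambda>i j x. x (\<tau> (Suc j)) - x (\<tau> j)", OF fin(1) finite_lessThan Y])
      (use \<tau> \<tau>0 bm in \<open>auto simp: standard_brownian_motion_def intro!: borel_measurable_diff measurable_component_singleton\<close>)
  then have "indep_vars (\<lambda>_. borel) ?W (I \<times> {..<k})" by (simp add: case_prod_unfold)
  \<comment> \<open>The doubly indexed increments are grouped by time step, since each increment of
    the sum reads exactly one group \<open>I \<times> {j}\<close>.\<close>
  then have "indep_vars (\<lambda>j. PiM (I \<times> {j}) (\<lambda>_. borel)) (\<lambda>j \<omega>. \<lambda>p\<in>I \<times> {j}. ?W p \<omega>) {..<k}"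
    by (rule indep_vars_restrict) (auto simp: disjoint_family_on_def)
  then have "indep_vars (\<lambda>_. borel) (\<lambda>j \<omega>. (\<lambda>x. \<Sum>i\<in>I. c i * x (i, j)) (\<lambda>p\<in>I \<times> {j}. ?W p \<omega>)) {..<k}"
    by (rule indep_vars_compose2)
      (auto intro!: borel_measurable_sum borel_measurable_times measurable_component_singleton)
  then show "indep_vars (\<lambda>_. borel)
     (\<lambda>j \<omega>. (\<Sum>i\<in>I. c i * w i (\<tau> (Suc j)) \<omega>) - (\<Sum>i\<in>I. c i * w i (\<tau> j) \<omega>)) {..<k}"
    by (simp add: right_diff_distrib sum_subtractf)
qed

end

section \<open>Estimates for Brownian increments on a uniform mesh\<close>

definition mesh_increment :: "(real \<Rightarrow> 'a \<Rightarrow> real) \<Rightarrow> nat \<Rightarrow> nat \<Rightarrow> 'a \<Rightarrow> real" where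
  "mesh_increment B n j \<omega> = B (real (Suc j) / real n) \<omega> - B (real j / real n) \<omega>"

lemma std_normal_tail_pos: "0 < measure (density lborel std_normal_density) {x..}"
proof -
  interpret N: prob_space "density lborel std_normal_density"
    by (rule prob_space_normal_density) simp
  have "emeasure (density lborel std_normal_density) {x..} \<noteq> 0"
  proof
    assume "emeasure (density lborel std_normal_density) {x..} = 0"
    then have "AE y in lborel. y \<notin> {x..}"
      by (subst (asm) emeasure_density)
        (auto simp: nn_integral_0_iff_AE indicator_def normal_density_def elim!: eventually_mono split: if_splits)
    then have "AE y in lborel. \<not> y \<in> {x..x+1}" by eventually_elim auto
    from emeasure_eq_0_AE[OF this] have "emeasure lborel {x..x+1} = 0" by (simp del: atLeastAtMost_iff)
    then show False by simp
  qed
  then show ?thesis by (simp add: N.emeasure_eq_measure zero_less_measure_iff)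
qed

context prob_space begin

text \<open>Continuity of the measure from below: an almost sure statement with a random index
  becomes one with a deterministic index and probability close to 1.\<close>

lemma ex_prob_gt_incseq:
  fixes \<eta> :: real
  assumes P: "\<And>n. {\<omega>\<in>space M. P n \<omega>} \<in> events"
    and mono: "\<And>m n \<omega>. m \<le> n \<Longrightarrow> P m \<omega> \<Longrightarrow> P n \<omega>"
    and AE: "AE \<omega> in M. \<exists>n::nat. P n \<omega>" and "0 < \<eta>"
  obtains n where "0 < n" "1 - \<eta> < prob {\<omega>\<in>space M. P n \<omega>}"
proof -
  have "(\<lambda>n. prob {\<omega>\<in>space M. P n \<omega>}) \<longlonglongrightarrow> prob (\<Union>n. {\<omega>\<in>space M. P n \<omega>})"
    using P mono by (intro finite_Lim_measure_incseq) (auto simp: incseq_def)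
  also have "(\<Union>n. {\<omega>\<in>space M. P n \<omega>}) = {\<omega>\<in>space M. \<exists>n. P n \<omega>}" by auto
  also have "prob \<dots> = 1"
    using AE P by (intro prob_Collect_eq_1[THEN iffD2] sets.sets_Collect_countable_Ex) auto
  finally have "\<forall>\<^sub>F n in sequentially. 1 - \<eta> < prob {\<omega>\<in>space M. P n \<omega>}"
    using \<open>0 < \<eta>\<close> by (intro order_tendstoD) auto
  then have "\<forall>\<^sub>F n in sequentially. 0 < n \<and> 1 - \<eta> < prob {\<omega>\<in>space M. P n \<omega>}"
    using eventually_gt_at_top[of "0::nat"] by eventually_elim auto
  then show ?thesis using that by (auto simp: eventually_sequentially)
qed

text \<open>By independence both families have the same product measure as joint law. This allows
  the increments of a block to be moved to time 0.\<close>

lemma prob_indep_vars_eq: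
  assumes "finite J" "J \<noteq> {}" and X: "indep_vars (\<lambda>_. borel) X J" and Y: "indep_vars (\<lambda>_. borel) Y J"
    and XY: "\<And>j. j \<in> J \<Longrightarrow> distr M borel (X j) = distr M borel (Y j)"
    and Q: "Measurable.pred (PiM J (\<lambda>_. borel)) Q"
  shows "prob {\<omega>\<in>space M. Q (\<lambda>j\<in>J. X j \<omega>)} = prob {\<omega>\<in>space M. Q (\<lambda>j\<in>J. Y j \<omega>)}"
proof -
  have *: "prob {\<omega>\<in>space M. Q (\<lambda>j\<in>J. Z j \<omega>)} =
      measure (\<Pi>\<^sub>M j\<in>J. distr M borel (Z j)) {x\<in>space (PiM J (\<lambda>_. borel)). Q x}"
    if Z: "indep_vars (\<lambda>_. borel) Z J" for Z :: "'b \<Rightarrow> 'a \<Rightarrow> 'c"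
  proof -
    have rv: "random_variable borel (Z j)" if "j \<in> J" for j
      using Z that by (auto simp: indep_vars_def2)
    then have m: "(\<lambda>\<omega>. \<lambda>j\<in>J. Z j \<omega>) \<in> measurable M (PiM J (\<lambda>_. borel))"
      by (intro measurable_restrict) auto
    have "measure (distr M (PiM J (\<lambda>_. borel)) (\<lambda>\<omega>. \<lambda>j\<in>J. Z j \<omega>)) {x\<in>space (PiM J (\<lambda>_. borel)). Q x}
      = prob {\<omega>\<in>space M. Q (\<lambda>j\<in>J. Z j \<omega>)}"
      using Q measurable_space[OF m] by (subst measure_distr[OF m]) (auto intro!: arg_cong[where f = prob])
    then show ?thesis
      using indep_vars_iff_distr_eq_PiM'[OF \<open>J \<noteq> {}\<close> rv] Z by simp
  qed
  have "(\<Pi>\<^sub>M j\<in>J. distr M borel (X j)) = (\<Pi>\<^sub>M j\<in>J. distr M borel (Y j))"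
    using XY by (intro PiM_cong) auto
  then show ?thesis by (simp add: *[OF X] *[OF Y])
qed

text \<open>For a level \<open>R \<ge> 0\<close> the tail grows with the standard deviation, so a
  lower bound \<open>s0\<close> yields an estimate uniform in \<open>s\<close>.\<close>

lemma prob_normal_tail_ge:
  assumes Z: "distributed M lborel Z (normal_density 0 s)" and s: "0 < s0" "s0 \<le> s" and "0 \<le> R"
  shows "measure (density lborel std_normal_density) {R / s0..} \<le> prob {\<omega>\<in>space M. R \<le> Z \<omega>}"
proof -
  interpret N: prob_space "density lborel std_normal_density"
    by (rule prob_space_normal_density) simp
  have d: "distributed M lborel (\<lambda>\<omega>. Z \<omega> / s) std_normal_density"
    using normal_standard_normal_convert[of s Z 0] s Z by simp
  have m: "(\<lambda>\<omega>. Z \<omega> / s) \<in> measurable M lborel" using d by (rule distributed_measurable)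
  have "measure (density lborel std_normal_density) {R / s0..}
      \<le> measure (density lborel std_normal_density) {R / s..}"
    using s \<open>0 \<le> R\<close> divide_left_mono[of s0 s R] by (intro N.finite_measure_mono) auto
  also have "\<dots> = measure (distr M lborel (\<lambda>\<omega>. Z \<omega> / s)) {R / s..}"
    using distributed_distr_eq_density[OF d] by simp
  also have "\<dots> = prob {\<omega>\<in>space M. R \<le> Z \<omega>}"
    using s by (subst measure_distr[OF m]) (auto intro!: arg_cong[where f = prob] simp: field_simps)
  finally show ?thesis .
qed

context
  fixes B
  assumes bm: "standard_brownian_motion M B"
begin

lemma brownian_measurable: "0 \<le> t \<Longrightarrow> B t \<in> borel_measurable M"
  using bm by (auto simp: standard_brownian_motion_def)

lemma mesh_increment_measurable: "mesh_increment B n j \<in> borel_measurable M"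
  unfolding mesh_increment_def[abs_def] by (intro borel_measurable_diff brownian_measurable) auto

lemma brownian_increment_distributed:
  "0 \<le> s \<Longrightarrow> s < t \<Longrightarrow> distributed M lborel (\<lambda>\<omega>. B t \<omega> - B s \<omega>) (normal_density 0 (sqrt (t - s)))"
  using bm by (auto simp: standard_brownian_motion_def)

lemma mesh_increment_distributed:
  assumes "0 < n"
  shows "distributed M lborel (mesh_increment B n j) (normal_density 0 (sqrt (1 / n)))"
  using brownian_increment_distributed[of "real j / n" "real (Suc j) / n"] assms
  by (simp add: mesh_increment_def[abs_def] divide_strict_right_mono flip: diff_divide_distrib)

lemma mesh_increment_indep:
  assumes "0 < n"
  shows "indep_vars (\<lambda>_. borel) (\<lambda>j. mesh_increment B n (k + j)) {..<m}"
proof -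
  have "indep_vars (\<lambda>_. borel)
      (\<lambda>j \<omega>. B ((\<lambda>j. real (k + j) / n) (Suc j)) \<omega> - B ((\<lambda>j. real (k + j) / n) j) \<omega>) {..<m}"
    using bm assms unfolding standard_brownian_motion_def
    by (elim conjE allE[of _ m] allE[of _ "\<lambda>j. real (k + j) / n"]) (auto simp: divide_strict_right_mono)
  then show ?thesis by (simp add: mesh_increment_def[abs_def])
qed

lemma prob_mesh_partial_sums_bounded_below:
  obtains r where "\<And>n k. 0 < n \<Longrightarrow>
    1/2 \<le> prob {\<omega>\<in>space M. \<forall>m\<le>n. - real r \<le> (\<Sum>j<m. mesh_increment B n (k + j) \<omega>)}"
proof -
  \<comment> \<open>The law of the increments does not depend on \<open>k\<close>, and for \<open>k = 0\<close> all meshes are controlled at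
    once by the minimum of the path over \<open>[0, 1]\<close>. No maximal inequality is needed.\<close>
  define P where "P r \<omega> \<longleftrightarrow> (\<forall>t\<in>\<rat> \<inter> {0..1}. - real r \<le> B t \<omega> - B 0 \<omega>)" for r \<omega>
  obtain r where r: "1 - 1/2 < prob {\<omega>\<in>space M. P r \<omega>}"
  proof (rule ex_prob_gt_incseq[of P "1/2"])
    show "{\<omega>\<in>space M. P r \<omega>} \<in> events" for r
      unfolding P_def using countable_rat brownian_measurable
      by (intro sets.sets_Collect_countable_All') auto
    show "P m \<omega> \<Longrightarrow> P n \<omega>" if "m \<le> n" for m n \<omega> using that unfolding P_def by force
    have "AE \<omega> in M. continuous_on {0..} (\<lambda>t. B t \<omega>)"
      using bm by (auto simp: standard_brownian_motion_def)
    then show "AE \<omega> in M. \<exists>r. P r \<omega>"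
    proof eventually_elim
      case (elim \<omega>)
      then have "continuous_on {0..1} (\<lambda>t. B t \<omega> - B 0 \<omega>)"
        by (intro continuous_intros) (auto elim: continuous_on_subset)
      then have "bounded ((\<lambda>t. B t \<omega> - B 0 \<omega>) ` {0..1})"
        by (intro compact_imp_bounded compact_continuous_image) auto
      then obtain C where C: "\<forall>t\<in>{0..1}. \<bar>B t \<omega> - B 0 \<omega>\<bar> \<le> C"
        by (auto simp: bounded_iff)
      obtain r :: nat where "C \<le> real r" using real_arch_simple by blast
      then have "P r \<omega>" unfolding P_def using C by fastforce
      then show ?case ..
    qed
  qed auto
  have "1/2 \<le> prob {\<omega>\<in>space M. \<forall>m\<le>n. - real r \<le> (\<Sum>j<m. mesh_increment B n (k + j) \<omega>)}"
    if n: "0 < n" for n k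
  proof -
    define Q where "Q x \<longleftrightarrow> (\<forall>m\<in>{..n}. - real r \<le> (\<Sum>j<m. x j))" for x :: "nat \<Rightarrow> real"
    have Q: "Measurable.pred (PiM {..<n} (\<lambda>_. borel)) Q"
      unfolding Q_def by (intro pred_intros_finite borel_measurable_le
        borel_measurable_sum measurable_component_singleton) auto
    have Qr: "Q (\<lambda>j\<in>{..<n}. x j) \<longleftrightarrow> (\<forall>m\<le>n. - real r \<le> (\<Sum>j<m. x j))" for x
      unfolding Q_def by (auto intro!: sum.cong)
    have "1/2 \<le> prob {\<omega>\<in>space M. P r \<omega>}" using r by simp
    also have "\<dots> \<le> prob {\<omega>\<in>space M. \<forall>m\<le>n. - real r \<le> (\<Sum>j<m. mesh_increment B n (0 + j) \<omega>)}"
    proof (rule finite_measure_mono)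
      show "{\<omega>\<in>space M. \<forall>m\<le>n. - real r \<le> (\<Sum>j<m. mesh_increment B n (0 + j) \<omega>)} \<in> events"
        using mesh_increment_measurable by measurable
      show "{\<omega>\<in>space M. P r \<omega>} \<subseteq> {\<omega>\<in>space M. \<forall>m\<le>n. - real r \<le> (\<Sum>j<m. mesh_increment B n (0 + j) \<omega>)}"
      proof safe
        fix \<omega> m assume "P r \<omega>" "m \<le> n"
        moreover have "(\<Sum>j<m. mesh_increment B n (0 + j) \<omega>) = B (real m / n) \<omega> - B 0 \<omega>"
          unfolding mesh_increment_def using sum_lessThan_telescope[of "\<lambda>j. B (real j / n) \<omega>" m] by simp
        \<comment> \<open>The mesh points \<open>m / n\<close> are rational and lie in
          \<open>{0..1}\<close>, where \<open>P r\<close> gives the bound.\<close>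
        ultimately show "- real r \<le> (\<Sum>j<m. mesh_increment B n (0 + j) \<omega>)"
          using n by (auto simp: P_def)
      qed
    qed
    also have "\<dots> = prob {\<omega>\<in>space M. Q (\<lambda>j\<in>{..<n}. mesh_increment B n (0 + j) \<omega>)}"
      by (simp only: Qr)
    also have "\<dots> = prob {\<omega>\<in>space M. Q (\<lambda>j\<in>{..<n}. mesh_increment B n (k + j) \<omega>)}"
    proof (rule prob_indep_vars_eq[OF _ _ mesh_increment_indep[OF n] mesh_increment_indep[OF n] _ Q])
      fix j
      have "distr M lborel (mesh_increment B n (0 + j)) = distr M lborel (mesh_increment B n (k + j))"
        using mesh_increment_distributed[OF n, THEN distributed_distr_eq_density] by simp
      then show "distr M borel (mesh_increment B n (0 + j)) = distr M borel (mesh_increment B n (k + j))"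
        by (simp add: distr_cong[OF refl sets_lborel[symmetric] refl])
    qed (use n in auto)
    finally show ?thesis by (simp only: Qr)
  qed
  then show ?thesis using that by blast
qed

text \<open>The sum is a centred Gaussian. Its last \<open>n\<close> increments, which cover one
  unit of time, carry weights at least \<open>exp (- l)\<close> and variance \<open>1 / n\<close>
  each, so its standard deviation is at least \<open>exp (- l)\<close> for every \<open>L\<close>
  and \<open>n\<close>.\<close>

lemma prob_mesh_exponential_sum_ge:
  assumes n: "0 < n" and L: "0 < L" and l: "0 \<le> l" and R: "0 \<le> R"
  shows "measure (density lborel std_normal_density) {R * exp l..} \<le>
    prob {\<omega>\<in>space M. R \<le> (\<Sum>j<L * n. exp (- l / real n) ^ (L * n - 1 - j) * mesh_increment B n (k + j) \<omega>)}"
proof -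
  define q where "q = exp (- l / real n)"
  define s where "s j = q ^ (L * n - 1 - j) * sqrt (1 / n)" for j
  have q: "0 < q" "q \<le> 1" using l by (auto simp: q_def)
  have Ln: "n \<le> L * n" using L by simp
  have "distributed M lborel (\<lambda>\<omega>. q ^ (L * n - 1 - j) * mesh_increment B n (k + j) \<omega>) (normal_density 0 (s j))" for j
    using normal_density_affine[OF mesh_increment_distributed[OF n, of "k + j"], of "q ^ (L * n - 1 - j)" 0] n q
    by (simp add: s_def)
  moreover have "indep_vars (\<lambda>_. borel) (\<lambda>j \<omega>. q ^ (L * n - 1 - j) * mesh_increment B n (k + j) \<omega>) {..<L * n}"
    by (intro indep_vars_compose2[OF mesh_increment_indep[OF n], where Y = "\<lambda>j x. q ^ (L * n - 1 - j) * x"]) auto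
  ultimately have d: "distributed M lborel (\<lambda>\<omega>. \<Sum>j<L * n. q ^ (L * n - 1 - j) * mesh_increment B n (k + j) \<omega>)
      (normal_density 0 (sqrt (\<Sum>j<L * n. (s j)\<^sup>2)))"
    using sum_indep_normal[of "{..<L * n}" "\<lambda>j \<omega>. q ^ (L * n - 1 - j) * mesh_increment B n (k + j) \<omega>" s "\<lambda>_. 0"]
      n L q by (simp add: s_def lessThan_empty_iff)
  have "(exp (- l))\<^sup>2 = (\<Sum>i<n. (exp (- l))\<^sup>2 / n)" using n by simp
  also have "\<dots> \<le> (\<Sum>i<n. (q ^ i)\<^sup>2 / n)"
  proof (intro sum_mono divide_right_mono power_mono)
    fix i assume "i \<in> {..<n}"
    then have "q ^ n \<le> q ^ i" using q by (intro power_decreasing) auto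
    moreover have "q ^ n = exp (- l)" using n by (simp add: q_def flip: exp_of_nat_mult)
    ultimately show "exp (- l) \<le> q ^ i" by simp
  qed auto
  also have "\<dots> \<le> (\<Sum>i<L * n. (q ^ i)\<^sup>2 / n)" using Ln by (intro sum_mono2) auto
  also have "\<dots> = (\<Sum>j<L * n. (s j)\<^sup>2)"
    unfolding s_def by (subst sum.nat_diff_reindex[symmetric]) (simp add: power_mult_distrib)
  finally have "exp (- l) \<le> sqrt (\<Sum>j<L * n. (s j)\<^sup>2)" by (rule real_le_rsqrt)
  from prob_normal_tail_ge[OF d _ this R] show ?thesis by (simp add: q_def exp_minus field_simps)
qed


text \<open>Almost every path is uniformly continuous on \<open>{0..c}\<close>, so a fine enough
  mesh works with probability close to 1. Rational times make the event a countable intersection and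
  hence measurable.\<close>

lemma brownian_small_oscillation:
  assumes "0 < e" "0 < \<eta>"
  obtains n where "0 < n"
    "{\<omega>\<in>space M. \<forall>s\<in>\<rat> \<inter> {0..c}. \<forall>t\<in>\<rat> \<inter> {0..c}. \<bar>s - t\<bar> \<le> 1 / real n \<longrightarrow> \<bar>B s \<omega> - B t \<omega>\<bar> \<le> e} \<in> events"
    "1 - \<eta> < prob {\<omega>\<in>space M. \<forall>s\<in>\<rat> \<inter> {0..c}. \<forall>t\<in>\<rat> \<inter> {0..c}. \<bar>s - t\<bar> \<le> 1 / real n \<longrightarrow> \<bar>B s \<omega> - B t \<omega>\<bar> \<le> e}"
proof -
  define P where "P n \<omega> \<longleftrightarrow> (\<forall>s\<in>\<rat> \<inter> {0..c}. \<forall>t\<in>\<rat> \<inter> {0..c}.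
    \<bar>s - t\<bar> \<le> 1 / real (Suc n) \<longrightarrow> \<bar>B s \<omega> - B t \<omega>\<bar> \<le> e)" for n \<omega>
  have P: "{\<omega>\<in>space M. P n \<omega>} \<in> events" for n
    unfolding P_def using countable_rat brownian_measurable
    by (intro sets.sets_Collect_countable_All' sets.sets_Collect_imp) auto
  obtain n where "1 - \<eta> < prob {\<omega>\<in>space M. P n \<omega>}"
  proof (rule ex_prob_gt_incseq[OF P])
    fix m n \<omega> assume mn: "m \<le> n" and Pm: "P m \<omega>"
    have "1 / real (Suc n) \<le> 1 / real (Suc m)" using mn by (intro divide_left_mono) auto
    with Pm show "P n \<omega>" unfolding P_def by (meson order_trans)
  next
    have "AE \<omega> in M. continuous_on {0..} (\<lambda>t. B t \<omega>)"
      using bm by (auto simp: standard_brownian_motion_def)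
    then show "AE \<omega> in M. \<exists>n. P n \<omega>"
    proof eventually_elim
      case (elim \<omega>)
      then have "continuous_on {0..c} (\<lambda>t. B t \<omega>)" by (rule continuous_on_subset) auto
      then have "uniformly_continuous_on {0..c} (\<lambda>t. B t \<omega>)"
        by (intro compact_uniformly_continuous) auto
      then obtain d where d: "0 < d" "\<And>s t. s \<in> {0..c} \<Longrightarrow> t \<in> {0..c} \<Longrightarrow> \<bar>s - t\<bar> < d \<Longrightarrow> \<bar>B s \<omega> - B t \<omega>\<bar> < e"
        using \<open>0 < e\<close> unfolding uniformly_continuous_on_def dist_real_def by metis
      obtain n where "1 / real (Suc n) < d" using nat_approx_posE[OF d(1)] by metis
      then have "P n \<omega>" unfolding P_def using d(2) by (meson IntD2 le_less_trans less_imp_le)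
      then show ?case ..
    qed
  qed (use \<open>0 < \<eta>\<close> in auto)
  then show ?thesis using that[of "Suc n"] P[of n] by (simp add: P_def del: of_nat_Suc)
qed

end

end

section \<open>Almost sure occurrence of a favourable window\<close>

text \<open>Returns from rational times to all times, by continuity and density of the
  rationals.\<close>

lemma oscillation_le_of_rational:
  fixes g :: "real \<Rightarrow> real"
  assumes g: "continuous_on {u..v} g" and u: "u \<in> \<rat>" and e: "0 \<le> e"
    and rat: "\<And>y. y \<in> \<rat> \<Longrightarrow> y \<in> {u..v} \<Longrightarrow> \<bar>g y - g u\<bar> \<le> e"
    and x: "x \<in> {u..v}"
  shows "\<bar>g x - g u\<bar> \<le> e"
proof (rule ccontr)
  assume "\<not> ?thesis"
  then have gt: "0 < \<bar>g x - g u\<bar> - e" by simp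
  with x g obtain d where d: "0 < d" "\<And>y. y \<in> {u..v} \<Longrightarrow> \<bar>y - x\<bar> < d \<Longrightarrow> \<bar>g y - g x\<bar> < \<bar>g x - g u\<bar> - e"
    unfolding continuous_on_iff dist_real_def by metis
  have "x \<noteq> u" using gt e by auto
  then have "max u (x - d) < x" using d(1) x by auto
  then obtain y where y: "y \<in> \<rat>" "max u (x - d) < y" "y < x" using Rats_dense_in_real by blast
  then have "\<bar>g y - g x\<bar> < \<bar>g x - g u\<bar> - e" using x by (intro d(2)) auto
  moreover have "\<bar>g y - g u\<bar> \<le> e" using y x by (intro rat) auto
  ultimately show False by linarith
qed

context prob_space begin

context
  fixes B
  assumes bm: "standard_brownian_motion M B"
begin

text \<open>The two conditions in \<open>high_window\<close> read increments before and after time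
  \<open>a + L\<close>, so they are independent and their probabilities multiply. The resulting
  bound depends on neither \<open>a\<close>, \<open>L\<close> nor \<open>n\<close>.\<close>

lemma prob_high_window_ge:
  assumes r: "\<And>n k. 0 < n \<Longrightarrow>
      1/2 \<le> prob {\<omega>\<in>space M. \<forall>m\<le>n. - r \<le> (\<Sum>j<m. mesh_increment B n (k + j) \<omega>)}"
    and n: "0 < n" and L: "0 < L" and l: "0 \<le> l" and R: "0 \<le> R"
  shows "measure (density lborel std_normal_density) {R * exp l..} / 2 \<le>
    prob {\<omega>\<in>space M. high_window l R r a L n (\<lambda>j. mesh_increment B n j \<omega>)}"
proof -
  \<comment> \<open>The two conditions are indexed by a boolean to fit the form of
    \<open>prob_indep_blocks\<close>; \<open>True\<close> is the exponential sum.\<close>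
  define Q where "Q b x \<longleftrightarrow> (if b then R \<le> (\<Sum>j<L * n. exp (- l / real n) ^ (L * n - 1 - j) * x (a * n + j))
    else \<forall>m\<in>{..n}. - r \<le> (\<Sum>j<m. x ((a + L) * n + j)))" for b and x :: "nat \<Rightarrow> real"
  define K where "K b = (if b then {a * n..<(a + L) * n} else {(a + L) * n..<(a + L) * n + n})" for b
  have Q: "Measurable.pred (PiM (K b) (\<lambda>_. borel)) (Q b)" for b
    by (cases b) (auto simp: Q_def[abs_def] K_def add_mult_distrib
      intro!: pred_intros_finite borel_measurable_le borel_measurable_sum
        borel_measurable_times measurable_component_singleton)
  have QK: "Q b (\<lambda>j\<in>K b. x j) = Q b x" for b x
    unfolding Q_def K_def by (cases b) (auto simp: add_mult_distrib intro!: sum.cong)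
  have "prob {\<omega>\<in>space M. \<forall>b\<in>UNIV. Q b (\<lambda>j\<in>K b. mesh_increment B n (0 + j) \<omega>)}
      = (\<Prod>b\<in>UNIV. prob {\<omega>\<in>space M. Q b (\<lambda>j\<in>K b. mesh_increment B n (0 + j) \<omega>)})"
    by (rule prob_indep_blocks[OF mesh_increment_indep[OF bm n, of 0 "(a + L) * n + n"] _ _ _ Q])
      (auto simp: K_def disjoint_family_on_def split: if_splits)
  then have "prob {\<omega>\<in>space M. high_window l R r a L n (\<lambda>j. mesh_increment B n j \<omega>)} =
      prob {\<omega>\<in>space M. \<forall>m\<le>n. - r \<le> (\<Sum>j<m. mesh_increment B n ((a + L) * n + j) \<omega>)} *
      prob {\<omega>\<in>space M. R \<le> (\<Sum>j<L * n. exp (- l / real n) ^ (L * n - 1 - j) * mesh_increment B n (a * n + j) \<omega>)}"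
    by (simp add: QK UNIV_bool) (simp add: Q_def high_window_def Ball_def conj_commute)
  moreover have "1 / 2 * measure (density lborel std_normal_density) {R * exp l..} \<le> \<dots>"
    by (intro mult_mono prob_mesh_exponential_sum_ge[OF bm n L l R] r n) auto
  ultimately show ?thesis by simp
qed

text \<open>Each window ends where the next one starts, so the windows use disjoint blocks of
  increments and their failures are independent.\<close>

lemma prob_no_high_window_le:
  assumes p: "\<And>k. k < m \<Longrightarrow> p \<le> prob {\<omega>\<in>space M. high_window l R r (a k) (L k) n (\<lambda>j. mesh_increment B n j \<omega>)}"
    and a: "\<And>k. a (Suc k) = a k + L k + 1" and n: "0 < n"
  shows "{\<omega>\<in>space M. \<forall>k<m. \<not> high_window l R r (a k) (L k) n (\<lambda>j. mesh_increment B n j \<omega>)} \<in> events" (is "?E \<in> _")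
    and "prob {\<omega>\<in>space M. \<forall>k<m. \<not> high_window l R r (a k) (L k) n (\<lambda>j. mesh_increment B n j \<omega>)} \<le> (1 - p) ^ m"
proof -
  define K where "K k = {a k * n..<a (Suc k) * n}" for k
  define Q where "Q k x \<longleftrightarrow> \<not> (R \<le> (\<Sum>j<L k * n. exp (- l / real n) ^ (L k * n - 1 - j) * x (a k * n + j)) \<and>
     (\<forall>m\<in>{..n}. - r \<le> (\<Sum>j<m. x ((a k + L k) * n + j))))" for k and x :: "nat \<Rightarrow> real"
  have Q_high: "Q k x \<longleftrightarrow> \<not> high_window l R r (a k) (L k) n x" for k x
    by (simp add: Q_def high_window_def Ball_def)
  have mono: "a k \<le> a k'" if "k \<le> k'" for k k'
    using lift_Suc_mono_le[of a, OF _ that] a by simp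
  have Q: "Measurable.pred (PiM (K k) (\<lambda>_. borel)) (Q k)" for k
    unfolding Q_def[abs_def] K_def a
    by (intro pred_intros_logic pred_intros_finite borel_measurable_le borel_measurable_sum
        borel_measurable_times measurable_component_singleton) (auto simp: add_mult_distrib)
  have QK: "Q k (\<lambda>j\<in>K k. x j) = Q k x" for k x
  proof -
    have "(\<Sum>j<L k * n. c j * (\<lambda>j\<in>K k. x j) (a k * n + j)) = (\<Sum>j<L k * n. c j * x (a k * n + j))" for c
      by (intro sum.cong) (auto simp: K_def a add_mult_distrib)
    moreover have "(\<Sum>j<m. (\<lambda>j\<in>K k. x j) ((a k + L k) * n + j)) = (\<Sum>j<m. x ((a k + L k) * n + j))" if "m \<in> {..n}" for m
      using that by (intro sum.cong) (auto simp: K_def a add_mult_distrib)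
    ultimately show ?thesis unfolding Q_def by (simp cong: ball_cong)
  qed
  have ev: "{\<omega>\<in>space M. high_window l R r (a k) (L k) n (\<lambda>j. mesh_increment B n j \<omega>)} \<in> events" for k
    unfolding high_window_def using mesh_increment_measurable[OF bm] by measurable
  then show "?E \<in> events" by measurable
  have "prob ?E = prob {\<omega>\<in>space M. \<forall>k\<in>{..<m}. Q k (\<lambda>j\<in>K k. mesh_increment B n (0 + j) \<omega>)}"
    by (simp only: QK) (simp add: Q_high Ball_def)
  also have "\<dots> = (\<Prod>k<m. prob {\<omega>\<in>space M. Q k (\<lambda>j\<in>K k. mesh_increment B n (0 + j) \<omega>)})"
  proof (rule prob_indep_blocks[OF mesh_increment_indep[OF bm n, of 0 "a m * n"] _ _ _ Q])
    show "K k \<subseteq> {..<a m * n}" if "k \<in> {..<m}" for k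
    proof -
      have "a (Suc k) * n \<le> a m * n" using mono[of "Suc k" m] that by simp
      then show ?thesis unfolding K_def
        by (meson atLeastLessThan_iff lessThan_iff order.strict_trans2 subsetI)
    qed
    have "K j \<inter> K k = {}" if "j < k" for j k
    proof -
      have "a (Suc j) * n \<le> a k * n" using mono[of "Suc j" k] that by simp
      then show ?thesis by (auto simp: K_def)
    qed
    then show "disjoint_family_on K {..<m}"
      unfolding disjoint_family_on_def by (metis Int_commute linorder_neqE_nat)
  qed auto
  also have "\<dots> = (\<Prod>k<m. 1 - prob {\<omega>\<in>space M. high_window l R r (a k) (L k) n (\<lambda>j. mesh_increment B n j \<omega>)})"
    by (simp only: QK) (simp add: Q_high prob_neg ev)
  also have "\<dots> \<le> (\<Prod>k<m. 1 - p)"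
    using p by (intro prod_mono) auto
  finally show "prob ?E \<le> (1 - p) ^ m" by simp
qed

text \<open>Enough consecutive windows make failure of all of them unlikely; their lengths are then
  chosen to make the contribution of \<open>Y\<close> small, and the mesh is chosen last. A union
  bound combines the three requirements, so \<open>Y\<close> may depend on the increments. The
  constant \<open>r\<close> is fixed before \<open>R\<close> because \<open>R\<close> will later be
  chosen in terms of \<open>r\<close>.\<close>

lemma AE_ex_high_window:
  assumes l: "0 < l" and e: "0 < e" and Y: "\<And>a::nat. Y a \<in> borel_measurable M"
  shows "\<exists>r. \<forall>R\<ge>0. AE \<omega> in M. \<exists>a L n. 0 < n \<and> exp (- l * real L) * \<bar>Y a \<omega>\<bar> \<le> 1 \<and>
      high_window l R r a L n (\<lambda>j. mesh_increment B n j \<omega>) \<and>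
      (\<forall>j<(a + L + 1) * n. \<forall>x\<in>{real j / n..real (Suc j) / n}. \<bar>B x \<omega> - B (real j / n) \<omega>\<bar> \<le> e)"
proof -
  obtain r :: nat where r: "\<And>n k. 0 < n \<Longrightarrow>
    1/2 \<le> prob {\<omega>\<in>space M. \<forall>m\<le>n. - real r \<le> (\<Sum>j<m. mesh_increment B n (k + j) \<omega>)}"
    using prob_mesh_partial_sums_bounded_below[OF bm] by blast
  show ?thesis
  proof (intro exI[of _ "real r"] allI impI)
    fix R :: real assume R: "0 \<le> R"
    define p where "p = measure (density lborel std_normal_density) {R * exp l..} / 2"
    define good where "good \<omega> \<longleftrightarrow> (\<exists>a L n. 0 < n \<and> exp (- l * real L) * \<bar>Y a \<omega>\<bar> \<le> 1 \<and>
      high_window l R (real r) a L n (\<lambda>j. mesh_increment B n j \<omega>) \<and>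
      (\<forall>j<(a + L + 1) * n. \<forall>x\<in>{real j / n..real (Suc j) / n}. \<bar>B x \<omega> - B (real j / n) \<omega>\<bar> \<le> e))" for \<omega>
    have p: "0 < p" "p \<le> 1"
      using std_normal_tail_pos prob_space.prob_le_1[OF prob_space_normal_density[of 1 0]]
      by (auto simp: p_def intro: order_trans[OF _ one_le_numeral])
    have "\<exists>E\<in>events. prob E \<le> \<delta> \<and> (AE \<omega> in M. \<omega> \<notin> E \<longrightarrow> good \<omega>)" if \<delta>: "0 < \<delta>" for \<delta>
    proof -
      obtain m where m: "(1 - p) ^ m < \<delta> / 3" using real_arch_pow_inv[of "\<delta> / 3" "1 - p"] p \<delta> by auto
      \<comment> \<open>Makes the total failure probability of \<open>m\<close> windows on account
        of \<open>Y\<close> at most \<open>\<delta> / 3\<close>.\<close>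
      define \<eta> where "\<eta> = \<delta> / (3 * (real m + 1))"
      have \<eta>: "0 < \<eta>" using \<delta> by (simp add: \<eta>_def)
      have evY: "{\<omega>\<in>space M. exp (- l * real L) * \<bar>Y a \<omega>\<bar> \<le> 1} \<in> events" for L a
        using Y by measurable
      \<comment> \<open>The length is deterministic: \<open>Y a\<close> is finite, so the decaying
        factor brings it below 1 with high probability once \<open>L\<close> is large.\<close>
      have "\<exists>L>0. 1 - \<eta> < prob {\<omega>\<in>space M. exp (- l * real L) * \<bar>Y a \<omega>\<bar> \<le> 1}" for a
      proof -
        obtain L where "0 < L" "1 - \<eta> < prob {\<omega>\<in>space M. exp (- l * real L) * \<bar>Y a \<omega>\<bar> \<le> 1}"
        proof (rule ex_prob_gt_incseq[OF evY _ _ \<eta>])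
          fix i j \<omega> assume "i \<le> (j::nat)" "exp (- l * real i) * \<bar>Y a \<omega>\<bar> \<le> 1"
          moreover have "exp (- l * real j) * \<bar>Y a \<omega>\<bar> \<le> exp (- l * real i) * \<bar>Y a \<omega>\<bar>"
            using l \<open>i \<le> j\<close> by (intro mult_right_mono) auto
          ultimately show "exp (- l * real j) * \<bar>Y a \<omega>\<bar> \<le> 1" by linarith
        next
          show "AE \<omega> in M. \<exists>n. exp (- l * real n) * \<bar>Y a \<omega>\<bar> \<le> 1"
          proof (rule AE_I2)
            fix \<omega>
            obtain n where "\<bar>Y a \<omega>\<bar> < real n * l" using reals_Archimedean3[OF l] by blast
            also have "\<dots> \<le> exp (l * real n)" using exp_ge_add_one_self[of "l * real n"] by (simp add: mult.commute del: exp_ge_add_one_self)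
            finally show "\<exists>n. exp (- l * real n) * \<bar>Y a \<omega>\<bar> \<le> 1"
              by (intro exI[of _ n]) (simp add: exp_minus field_simps)
          qed
        qed
        then show ?thesis by blast
      qed
      then obtain L where L: "\<And>a. 0 < L a" "\<And>a. 1 - \<eta> < prob {\<omega>\<in>space M. exp (- l * real (L a)) * \<bar>Y a \<omega>\<bar> \<le> 1}"
        by metis
      \<comment> \<open>Consecutive windows \<open>[a k, a k + L (a k) + 1]\<close>; only afterwards is one mesh fixed for all of them.\<close>
      define a where "a k = ((\<lambda>a. a + L a + 1) ^^ k) 0" for k
      have a: "a (Suc k) = a k + L (a k) + 1" for k by (simp add: a_def)
      have mono: "a k \<le> a k'" if "k \<le> k'" for k k'
        using lift_Suc_mono_le[of a, OF _ that] a by simp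
      have "0 < \<delta> / 3" using \<delta> by simp
      from brownian_small_oscillation[OF bm e this, of "real (a m)"] obtain n where n: "0 < n"
        and osc: "{\<omega>\<in>space M. \<forall>s\<in>\<rat> \<inter> {0..real (a m)}. \<forall>t\<in>\<rat> \<inter> {0..real (a m)}. \<bar>s - t\<bar> \<le> 1 / real n \<longrightarrow> \<bar>B s \<omega> - B t \<omega>\<bar> \<le> e} \<in> events"
          (is "?O \<in> _")
        "1 - \<delta> / 3 < prob {\<omega>\<in>space M. \<forall>s\<in>\<rat> \<inter> {0..real (a m)}. \<forall>t\<in>\<rat> \<inter> {0..real (a m)}. \<bar>s - t\<bar> \<le> 1 / real n \<longrightarrow> \<bar>B s \<omega> - B t \<omega>\<bar> \<le> e}"
        by blast
      define E1 where "E1 = {\<omega>\<in>space M. \<forall>k<m. \<not> high_window l R (real r) (a k) (L (a k)) n (\<lambda>j. mesh_increment B n j \<omega>)}"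
      define E2 where "E2 k = space M - {\<omega>\<in>space M. exp (- l * real (L (a k))) * \<bar>Y (a k) \<omega>\<bar> \<le> 1}" for k
      have hw: "p \<le> prob {\<omega>\<in>space M. high_window l R (real r) (a k) (L (a k)) n (\<lambda>j. mesh_increment B n j \<omega>)}" for k
        unfolding p_def by (rule prob_high_window_ge[OF r n L(1) less_imp_le[OF l] R])
      have E1: "E1 \<in> events" "prob E1 \<le> (1 - p) ^ m"
        unfolding E1_def by (rule prob_no_high_window_le[where a = a and L = "\<lambda>k. L (a k)", OF hw a n])+
      have E2: "E2 k \<in> events" "prob (E2 k) \<le> \<eta>" for k
        unfolding E2_def using evY L(2)[of "a k"] by (auto simp: prob_compl)
      have O: "space M - ?O \<in> events" "prob (space M - ?O) \<le> \<delta> / 3"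
        using osc by (auto simp: prob_compl)
      define E where "E = E1 \<union> (\<Union>k<m. E2 k) \<union> (space M - ?O)"
      have "E \<in> events" unfolding E_def using E1 E2 O by auto
      moreover have "prob E \<le> \<delta>"
      proof -
        have "prob E \<le> prob (E1 \<union> (\<Union>k<m. E2 k)) + prob (space M - ?O)"
          unfolding E_def using E1 E2 O by (intro measure_Un_le) auto
        also have "prob (E1 \<union> (\<Union>k<m. E2 k)) \<le> prob E1 + prob (\<Union>k<m. E2 k)"
          using E1 E2 by (intro measure_Un_le) auto
        also have "prob (\<Union>k<m. E2 k) \<le> (\<Sum>k<m. prob (E2 k))"
          using E2 by (intro finite_measure_subadditive_finite) auto
        also have "\<dots> \<le> (\<Sum>k<m. \<eta>)" using E2 by (intro sum_mono)
        also have "\<dots> = \<delta> / 3 * (real m / (real m + 1))" by (simp add: \<eta>_def field_simps)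
        also have "\<dots> \<le> \<delta> / 3 * 1" using \<delta> by (intro mult_left_mono) auto
        finally show ?thesis using E1 O m by linarith
      qed
      moreover have "AE \<omega> in M. \<omega> \<notin> E \<longrightarrow> good \<omega>"
      proof -
        have "AE \<omega> in M. continuous_on {0..} (\<lambda>t. B t \<omega>)"
          using bm by (auto simp: standard_brownian_motion_def)
        then show ?thesis using AE_space
        proof eventually_elim
          case (elim \<omega>)
          show ?case
          proof
            assume nE: "\<omega> \<notin> E"
            then obtain k where k: "k < m" "high_window l R (real r) (a k) (L (a k)) n (\<lambda>j. mesh_increment B n j \<omega>)"
              using elim by (auto simp: E_def E1_def)
            have Yk: "exp (- l * real (L (a k))) * \<bar>Y (a k) \<omega>\<bar> \<le> 1"
              using nE elim k(1) by (auto simp: E_def E2_def)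
            have O\<omega>: "\<omega> \<in> ?O" using nE elim by (auto simp: E_def)
            have "\<bar>B x \<omega> - B (real j / n) \<omega>\<bar> \<le> e"
              if j: "j < (a k + L (a k) + 1) * n" and x: "x \<in> {real j / n..real (Suc j) / n}" for j x
            proof (rule oscillation_le_of_rational[OF _ _ _ _ x])
              \<comment> \<open>Window \<open>k\<close> ends at \<open>a (Suc k) \<le> a m\<close>,
                so the whole cell lies in the range of the oscillation event.\<close>
              have "Suc j \<le> a m * n"
                using j mono[of "Suc k" m] k(1) a[of k] by (metis Suc_leI mult_le_mono1 order.strict_trans2)
              then have "real (Suc j) \<le> real (a m) * real n" by (metis of_nat_le_iff of_nat_mult)
              then have jm: "real (Suc j) / n \<le> real (a m)" using n by (simp add: pos_divide_le_eq)
              show "continuous_on {real j / n..real (Suc j) / n} (\<lambda>t. B t \<omega>)"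
                using elim(1)
              proof (rule continuous_on_subset)
                have "0 \<le> real j / n" by simp
                then show "{real j / n..real (Suc j) / n} \<subseteq> {0..}"
                  by (meson atLeastAtMost_iff atLeast_iff order_trans subsetI)
              qed
              show "real j / n \<in> \<rat>" by simp
              show "0 \<le> e" using e by simp
              fix y :: real assume y: "y \<in> \<rat>" "y \<in> {real j / n..real (Suc j) / n}"
              have "real j / n \<le> y" "y \<le> real (Suc j) / n" "0 \<le> real j / n" using y(2) by auto
              then have "0 \<le> y" "y \<le> real (a m)" "real j / n \<le> real (a m)" using jm by linarith+
              then have "y \<in> \<rat> \<inter> {0..real (a m)}" "real j / n \<in> \<rat> \<inter> {0..real (a m)}"
                using y(1) by auto
              moreover have "\<bar>y - real j / n\<bar> \<le> 1 / n" using y by (auto simp: add_divide_distrib)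
              ultimately show "\<bar>B y \<omega> - B (real j / n) \<omega>\<bar> \<le> e" using O\<omega> by blast
            qed
            then show "good \<omega>" unfolding good_def using n Yk k(2) by blast
          qed
        qed
      qed
      ultimately show ?thesis by blast
    qed
    \<comment> \<open>Exceptional events of probability tending to 0 intersect in a null set.
      Working with these events avoids any measurability question about \<open>good\<close>.\<close>
    then have "\<exists>E\<in>events. prob E \<le> 1 / real (Suc i) \<and> (AE \<omega> in M. \<omega> \<notin> E \<longrightarrow> good \<omega>)" for i
      by simp
    then obtain E where E: "\<And>i. E i \<in> events" "\<And>i. prob (E i) \<le> 1 / real (Suc i)"
      "\<And>i. AE \<omega> in M. \<omega> \<notin> E i \<longrightarrow> good \<omega>" by metis
    have *: "prob (\<Inter>i. E i) \<le> 1 / real (Suc i)" for i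
      by (rule order_trans[OF finite_measure_mono E(2)]) (use E(1) in auto)
    have "prob (\<Inter>i. E i) \<le> 0"
    proof (rule field_le_epsilon)
      fix d :: real assume "0 < d"
      then obtain i where "1 / real (Suc i) < d" using nat_approx_posE by metis
      with * [of i] show "prob (\<Inter>i. E i) \<le> 0 + d" by linarith
    qed
    then have "(\<Inter>i. E i) \<in> null_sets M"
      using E(1) by (intro null_setsI) (auto simp: emeasure_eq_measure order_antisym measure_nonneg)
    then have "AE \<omega> in M. \<omega> \<notin> (\<Inter>i. E i)" by (rule AE_not_in)
    moreover have "AE \<omega> in M. \<forall>i. \<omega> \<notin> E i \<longrightarrow> good \<omega>" unfolding AE_all_countable using E(3) by blast
    ultimately have "AE \<omega> in M. good \<omega>" by eventually_elim blast
    then show "AE \<omega> in M. \<exists>a L n. 0 < n \<and> exp (- l * real L) * \<bar>Y a \<omega>\<bar> \<le> 1 \<and>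
      high_window l R (real r) a L n (\<lambda>j. mesh_increment B n j \<omega>) \<and>
      (\<forall>j<(a + L + 1) * n. \<forall>x\<in>{real j / n..real (Suc j) / n}. \<bar>B x \<omega> - B (real j / n) \<omega>\<bar> \<le> e)"
      by (simp only: good_def)
  qed
qed

end

end

section \<open>A favourable window excludes a global scalar solution\<close>

text \<open>Iterating the linear decay over the cells of \<open>[a, a + L]\<close> lifts
  \<open>S\<close> to at least \<open>\<kappa> * R - 2\<close> at time \<open>a + L\<close>, after
  which \<open>no_solution_past_threshold\<close> applies. The constant 3 in \<open>R\<close> is
  made of 1 for the remnant of \<open>S a\<close>, 1 for the shift carried by \<open>V\<close>, and
  1 for the oscillation between mesh points after \<open>a + L\<close>.\<close>

lemma high_window_imp_no_solution:
  fixes f S F B :: "real \<Rightarrow> real"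
  assumes contf: "continuous_on UNIV f" and nonneg: "\<And>x. 0 \<le> f x"
    and x0: "0 < x0" "\<And>x. x0 \<le> x \<Longrightarrow> 0 < f x" "\<And>x. x0 \<le> x \<Longrightarrow> 2 * l * x \<le> f x"
      "\<And>x y. x0 \<le> x \<Longrightarrow> x \<le> y \<Longrightarrow> f x \<le> f y"
      "\<And>y. x0 \<le> y \<Longrightarrow> integral {x0..y} (\<lambda>s. 1 / f s) < 1/2"
    and l: "0 < l" and \<kappa>: "0 < \<kappa>"
    and S: "continuous_on {0..} S" and F: "continuous_on {0..} F"
    and eq: "\<And>t. 0 \<le> t \<Longrightarrow> S t = S0 + integral {0..t} (\<lambda>s. F s - l * S s) + \<kappa> * B t"
    and FS: "\<And>t. 0 \<le> t \<Longrightarrow> f (S t) \<le> F t"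
    and n: "0 < n"
    and decay: "exp (- l * real L) * \<bar>S (real a)\<bar> \<le> 1"
    and win: "high_window l R r a L n (\<lambda>j. B (real (Suc j) / real n) - B (real j / real n))"
    and R: "x0 + l * x0 + \<kappa> * r + 3 \<le> \<kappa> * R"
    and osc: "\<And>j x. j < (a + L + 1) * n \<Longrightarrow> x \<in> {real j / n..real (Suc j) / n} \<Longrightarrow>
      \<bar>B x - B (real j / n)\<bar> \<le> 1 / \<kappa>"
  shows False
proof -
  have eq': "S t = S s + integral {s..t} (\<lambda>s. F s - l * S s) + (\<kappa> * B t - \<kappa> * B s)"
    if "0 \<le> s" "s \<le> t" for s t
  proof -
    have "(\<lambda>s. F s - l * S s) integrable_on {0..t}"
      by (intro integrable_continuous_real continuous_intros continuous_on_subset[OF S] continuous_on_subset[OF F]) auto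
    then have "integral {0..s} (\<lambda>s. F s - l * S s) + integral {s..t} (\<lambda>s. F s - l * S s)
        = integral {0..t} (\<lambda>s. F s - l * S s)"
      using that by (intro Henstock_Kurzweil_Integration.integral_combine) auto
    then show ?thesis using eq[of s] eq[of t] that by simp
  qed
  have osc\<kappa>: "\<bar>\<kappa> * B x - \<kappa> * B (real j / n)\<bar> \<le> 1"
    if "j < (a + L + 1) * n" "x \<in> {real j / n..real (Suc j) / n}" for j x
    using mult_left_mono[OF osc[OF that], of \<kappa>] \<kappa> by (simp add: abs_mult flip: right_diff_distrib)
  have sub: "{u..v} \<subseteq> {0..}" if "0 \<le> u" for u v :: real using that by auto
  define q where "q = exp (- l / real n)"
  have q0: "0 \<le> q" unfolding q_def by (rule exp_ge_zero)
  \<comment> \<open>The shift 1 is the bound on the oscillation of \<open>\<kappa> * B\<close>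
    within a cell, as required by \<open>linear_decay_cell\<close>.\<close>
  define V where "V j = S (real (a * n + j) / n) + 1" for j
  define X where "X j = \<kappa> * B (real (Suc (a * n + j)) / n) - \<kappa> * B (real (a * n + j) / n)" for j
  have "q * V j + X j \<le> V (Suc j)" if j: "j < L * n" for j
  proof -
    let ?s = "real (a * n + j) / n" and ?t = "real (Suc (a * n + j)) / n"
    have st: "0 \<le> ?s" "?s \<le> ?t" by (auto intro!: divide_right_mono)
    have jn: "a * n + j < (a + L + 1) * n" using j by (simp add: add_mult_distrib)
    have "exp (- l * (?t - ?s)) * (S ?s + 1) + (\<kappa> * B ?t - \<kappa> * B ?s) \<le> S ?t + 1"
    proof (rule linear_decay_cell[where F = F])
      show "continuous_on {?s..?t} S" "continuous_on {?s..?t} F"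
        using sub[OF st(1)] by (blast intro: continuous_on_subset[OF S] continuous_on_subset[OF F])+
      fix x assume x: "x \<in> {?s..?t}"
      then have "?s \<le> x" by simp
      with st(1) have x0: "0 \<le> x" "?s \<le> x" by linarith+
      show "S x = S ?s + integral {?s..x} (\<lambda>y. F y - l * S y) + (\<kappa> * B x - \<kappa> * B ?s)"
        by (rule eq'[OF st(1) x0(2)])
      show "0 \<le> F x" using FS[OF x0(1)] nonneg[of "S x"] by linarith
      show "\<kappa> * B x - \<kappa> * B ?s \<le> 1" using osc\<kappa>[OF jn x] by linarith
    qed (use st l in auto)
    moreover have "- l * (?t - ?s) = - l / n" by (simp flip: diff_divide_distrib)
    ultimately show ?thesis by (simp add: V_def X_def q_def)
  qed
  then have "q ^ (L * n) * V 0 + (\<Sum>j<L * n. q ^ (L * n - 1 - j) * X j) \<le> V (L * n)"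
    using q0 by (rule linear_recursion_lower_bound)
  moreover have "V (L * n) = S (real a + real L) + 1"
    using n by (simp add: V_def add_divide_distrib)
  moreover have "- 1 \<le> q ^ (L * n) * V 0"
  proof -
    have qL: "q ^ (L * n) = exp (- l * real L)"
      using n by (simp add: q_def mult.commute flip: exp_of_nat_mult)
    have "exp (- l * real L) * (- \<bar>S (real a)\<bar>) \<le> exp (- l * real L) * (S (real a) + 1)"
      by (intro mult_left_mono) auto
    then show ?thesis using decay n by (simp add: qL V_def)
  qed
  moreover have "\<kappa> * R \<le> (\<Sum>j<L * n. q ^ (L * n - 1 - j) * X j)"
  proof -
    have "\<kappa> * R \<le> \<kappa> * (\<Sum>j<L * n. q ^ (L * n - 1 - j) * (B (real (Suc (a * n + j)) / n) - B (real (a * n + j) / n)))"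
      using win \<kappa> by (intro mult_left_mono) (auto simp: high_window_def q_def)
    also have "\<dots> = (\<Sum>j<L * n. q ^ (L * n - 1 - j) * X j)"
      by (simp add: X_def sum_distrib_left algebra_simps)
    finally show ?thesis .
  qed
  ultimately have high: "x0 + l * x0 + (\<kappa> * r + 1) \<le> S (real (a + L))" using R by simp
  show False
  proof (rule no_solution_past_threshold[OF contf nonneg x0 less_imp_le[OF l], where b = "real (a + L)"
        and S = S and F = F and N = "\<lambda>t. \<kappa> * B t" and \<rho> = "\<kappa> * r + 1"])
    show "continuous_on {real (a + L)..real (a + L) + 1} S" "continuous_on {real (a + L)..real (a + L) + 1} F"
      by (auto intro: continuous_on_subset[OF S] continuous_on_subset[OF F])
    show "x0 + l * x0 + (\<kappa> * r + 1) \<le> S (real (a + L))" by (rule high)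
    fix t assume t: "t \<in> {real (a + L)..real (a + L) + 1}"
    then have t0: "0 \<le> t" "real (a + L) \<le> t" "t \<le> real (a + L) + 1" by auto
    show "S t = S (real (a + L)) + integral {real (a + L)..t} (\<lambda>s. F s - l * S s) + (\<kappa> * B t - \<kappa> * B (real (a + L)))"
      using t0 by (intro eq') auto
    show "f (S t) \<le> F t" using t0 by (intro FS)
    \<comment> \<open>The last mesh point not after \<open>t\<close>: the window controls
      \<open>B\<close> there, and the oscillation bound carries this over to
      \<open>t\<close>.\<close>
    define j where "j = nat \<lfloor>t * n\<rfloor>"
    have tn: "real j \<le> t * n" "t * n < real (Suc j)" using t0 n by (auto simp: j_def) linarith
    have jl: "(a + L) * n \<le> j"
      using t0 mult_right_mono[of "real (a + L)" t "real n"] unfolding j_def by (simp add: le_nat_floor le_floor_iff del: of_nat_add)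
    have "real j \<le> (real (a + L) + 1) * real n" using tn(1) mult_right_mono[OF t0(3), of "real n"] by simp
    then have "real j \<le> real ((a + L + 1) * n)" by (simp add: algebra_simps)
    then have ju: "j \<le> (a + L + 1) * n" by (simp only: of_nat_le_iff)
    define m where "m = j - (a + L) * n"
    have m: "m \<le> n" "j = (a + L) * n + m" using jl ju by (auto simp: m_def)
    have "(\<Sum>i<m. B (real (Suc ((a + L) * n + i)) / n) - B (real ((a + L) * n + i) / n))
        = B (real j / n) - B (real (a + L))"
      using sum_lessThan_telescope[of "\<lambda>i. B (real ((a + L) * n + i) / n)" m] n m(2) by simp
    moreover have "- r \<le> (\<Sum>i<m. B (real (Suc ((a + L) * n + i)) / n) - B (real ((a + L) * n + i) / n))"
      using win m(1) by (simp add: high_window_def)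
    ultimately have "\<kappa> * (- r) \<le> \<kappa> * (B (real j / n) - B (real (a + L)))"
      using \<kappa> by (intro mult_left_mono) auto
    moreover have "\<kappa> * B (real j / n) - 1 \<le> \<kappa> * B t"
    proof (cases "j < (a + L + 1) * n")
      case True
      have "t \<in> {real j / n..real (Suc j) / n}" using tn n by (simp add: field_simps)
      from osc\<kappa>[OF True this] show ?thesis by linarith
    next
      \<comment> \<open>Here \<open>t\<close> is the right end of the window: it is itself a mesh
        point, and no further cell is available.\<close>
      case False
      then have "j = (a + L + 1) * n" using ju by simp
      then have "real j = (real (a + L) + 1) * real n" by (simp add: algebra_simps)
      then have "real j / n = real (a + L) + 1" using n by simp
      moreover have "real j / n \<le> t" using tn n by (simp add: field_simps)
      ultimately show ?thesis using t0 by simp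
    qed
    ultimately show "- (\<kappa> * r + 1) \<le> \<kappa> * B t - \<kappa> * B (real (a + L))" by (simp add: algebra_simps)
  qed
qed

section \<open>The first eigenvector of the discrete Dirichlet Laplacian\<close>

text \<open>The eigenvector is a half period of the sine between the boundary nodes, positive in
  between, and the eigenvalue comes from the addition formula. Summation by parts moves the
  difference operator from \<open>u\<close> onto it. Normalization to sum 1 turns it into weights
  for Jensen's inequality.\<close>

lemma ex_dirichlet_eigenvector:
  fixes h :: real
  assumes n: "3 \<le> n" and h: "0 < h"
  obtains \<phi> :: "nat \<Rightarrow> real" and l where "0 < l" "\<And>i. i \<in> {2..n-1} \<Longrightarrow> 0 < \<phi> i" "(\<Sum>i\<in>{2..n-1}. \<phi> i) = 1"
    "\<And>u. u 1 = 0 \<Longrightarrow> u n = 0 \<Longrightarrow>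
      (\<Sum>i\<in>{2..n-1}. \<phi> i * (1 / h\<^sup>2 * (u (i + 1) - 2 * u i + u (i - 1)))) = - l * (\<Sum>i\<in>{2..n-1}. \<phi> i * u i)"
proof -
  \<comment> \<open>The boundary nodes are 1 and \<open>n\<close>, so there are \<open>n - 1\<close>
    mesh steps and the sine starts at index 1; \<open>h\<close> enters only as a scaling of the
    eigenvalue.\<close>
  define \<theta> where "\<theta> = pi / (real n - 1)"
  define \<psi> where "\<psi> i = sin (\<theta> * (real i - 1))" for i :: nat
  define c where "c = (\<Sum>i\<in>{2..n-1}. \<psi> i)"
  define l where "l = (2 - 2 * cos \<theta>) / h\<^sup>2"
  have \<theta>: "0 < \<theta>" "\<theta> < pi" using n by (auto simp: \<theta>_def field_simps)
  have \<psi>: "0 < \<psi> i" if "i \<in> {2..n-1}" for i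
  proof -
    have "real i - 1 < real n - 1" "0 < real i - 1" using that n by auto
    then have "\<theta> * (real i - 1) < \<theta> * (real n - 1)" "0 < \<theta> * (real i - 1)"
      using \<theta> by (auto intro: mult_strict_left_mono)
    moreover have "\<theta> * (real n - 1) = pi" using n by (simp add: \<theta>_def)
    ultimately show ?thesis by (simp add: \<psi>_def sin_gt_zero)
  qed
  have c: "0 < c" unfolding c_def using n \<psi> by (intro sum_pos) auto
  have "cos \<theta> < 1" using cos_monotone_0_pi[of 0 \<theta>] \<theta> by simp
  then have l: "0 < l" using h by (simp add: l_def)
  have \<psi>_bdry: "\<psi> 1 = 0" "\<psi> n = 0" using n by (auto simp: \<psi>_def \<theta>_def)
  have eigen: "\<psi> (i + 1) + \<psi> (i - 1) = 2 * cos \<theta> * \<psi> i" if "i \<in> {2..n-1}" for i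
  proof -
    have "\<psi> (i + 1) = sin (\<theta> * (real i - 1) + \<theta>)" "\<psi> (i - 1) = sin (\<theta> * (real i - 1) - \<theta>)"
      using that by (auto simp: \<psi>_def of_nat_diff algebra_simps)
    then show ?thesis by (simp add: sin_add sin_diff \<psi>_def)
  qed
  have sum: "(\<Sum>i\<in>{2..n-1}. \<psi> i * (1 / h\<^sup>2 * (u (i + 1) - 2 * u i + u (i - 1)))) = - l * (\<Sum>i\<in>{2..n-1}. \<psi> i * u i)"
    if u: "u 1 = 0" "u n = 0" for u :: "nat \<Rightarrow> real"
  proof -
    \<comment> \<open>Summation by parts: both sums telescope, and the boundary values of
      \<open>\<psi>\<close> and \<open>u\<close> remove what remains.\<close>
    have 1: "(\<Sum>i\<in>{2..n-1}. \<psi> i * u (i + 1) - \<psi> (i - 1) * u i) = 0"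
      using sum_telescope''[of 1 "n - 1" "\<lambda>i. \<psi> i * u (i + 1)"] n u \<psi>_bdry
      by (simp add: numeral_2_eq_2)
    have 2: "(\<Sum>i\<in>{2..n-1}. \<psi> (i + 1) * u i - \<psi> i * u (i - 1)) = 0"
      using sum_telescope''[of 1 "n - 1" "\<lambda>i. \<psi> (i + 1) * u i"] n u \<psi>_bdry
      by (simp add: numeral_2_eq_2)
    have "(\<Sum>i\<in>{2..n-1}. \<psi> i * (u (i + 1) - 2 * u i + u (i - 1)))
        = (\<Sum>i\<in>{2..n-1}. (\<psi> i * u (i + 1) - \<psi> (i - 1) * u i) - (\<psi> (i + 1) * u i - \<psi> i * u (i - 1))
            + (\<psi> (i + 1) + \<psi> (i - 1) - 2 * \<psi> i) * u i)"
      by (intro sum.cong refl) (simp add: algebra_simps)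
    also have "\<dots> = (\<Sum>i\<in>{2..n-1}. (\<psi> (i + 1) + \<psi> (i - 1) - 2 * \<psi> i) * u i)"
      by (simp only: sum.distrib sum_subtractf[of _ "\<lambda>i. \<psi> (i + 1) * u i - \<psi> i * u (i - 1)"] 1 2)
    also have "\<dots> = (\<Sum>i\<in>{2..n-1}. - (2 - 2 * cos \<theta>) * (\<psi> i * u i))"
    proof (intro sum.cong refl)
      fix i assume "i \<in> {2..n-1}"
      then show "(\<psi> (i + 1) + \<psi> (i - 1) - 2 * \<psi> i) * u i = - (2 - 2 * cos \<theta>) * (\<psi> i * u i)"
        by (simp only: eigen) (simp add: algebra_simps)
    qed
    also have "\<dots> = - (2 - 2 * cos \<theta>) * (\<Sum>i\<in>{2..n-1}. \<psi> i * u i)" by (simp add: sum_distrib_left)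
    finally have "1 / h\<^sup>2 * (\<Sum>i\<in>{2..n-1}. \<psi> i * (u (i + 1) - 2 * u i + u (i - 1)))
        = 1 / h\<^sup>2 * (- (2 - 2 * cos \<theta>) * (\<Sum>i\<in>{2..n-1}. \<psi> i * u i))" by (simp only:)
    also have "\<dots> = - l * (\<Sum>i\<in>{2..n-1}. \<psi> i * u i)" by (simp add: l_def minus_divide_left)
    finally have "1 / h\<^sup>2 * (\<Sum>i\<in>{2..n-1}. \<psi> i * (u (i + 1) - 2 * u i + u (i - 1))) = - l * (\<Sum>i\<in>{2..n-1}. \<psi> i * u i)" .
    moreover have "(\<Sum>i\<in>{2..n-1}. \<psi> i * (1 / h\<^sup>2 * (u (i + 1) - 2 * u i + u (i - 1))))
        = 1 / h\<^sup>2 * (\<Sum>i\<in>{2..n-1}. \<psi> i * (u (i + 1) - 2 * u i + u (i - 1)))"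
      unfolding sum_distrib_left by (intro sum.cong refl) (simp add: algebra_simps)
    ultimately show ?thesis by simp
  qed
  show ?thesis
  proof (rule that[of l "\<lambda>i. \<psi> i / c"])
    show "(\<Sum>i\<in>{2..n-1}. \<psi> i / c) = 1" using c by (simp add: c_def flip: sum_divide_distrib)
    show "(\<Sum>i\<in>{2..n-1}. \<psi> i / c * (1 / h\<^sup>2 * (u (i + 1) - 2 * u i + u (i - 1)))) = - l * (\<Sum>i\<in>{2..n-1}. \<psi> i / c * u i)"
      if "u 1 = 0" "u n = 0" for u
    proof -
      have "(\<Sum>i\<in>{2..n-1}. \<psi> i / c * g i) = (\<Sum>i\<in>{2..n-1}. \<psi> i * g i) / c" for g
        by (simp add: sum_divide_distrib)
      then show ?thesis by (simp only: sum[OF that] times_divide_eq_right)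
    qed
  qed (use l \<psi> c in auto)
qed

section \<open>From the system to the scalar equation\<close>

lemma subalgebra_augmented_filtration:
  assumes "\<And>i s. i \<in> I \<Longrightarrow> 0 \<le> s \<Longrightarrow> w i s \<in> borel_measurable M"
  shows "subalgebra M (augmented_filtration M I w t)"
proof -
  let ?G = "{w i s -` A \<inter> space M | i s A. i \<in> I \<and> 0 \<le> s \<and> s \<le> t \<and> A \<in> sets borel} \<union> null_sets M"
  have G: "?G \<subseteq> sets M" using assms by (auto intro: measurable_sets)
  then have "?G \<subseteq> Pow (space M)" using sets.space_closed by (rule order_trans)
  then have "sets (sigma (space M) ?G) = sigma_sets (space M) ?G" "space (sigma (space M) ?G) = space M"
    by (rule sets_measure_of, rule space_measure_of)
  then show ?thesis
    unfolding subalgebra_def augmented_filtration_def using sets.sigma_sets_subset[OF G] by simp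
qed

theorem theorem4p1:
  fixes M :: "'a measure" and n :: nat and h \<sigma> :: real and f :: "real \<Rightarrow> real"
    and w U :: "nat \<Rightarrow> real \<Rightarrow> 'a \<Rightarrow> real" and U0 :: "nat \<Rightarrow> real" and T :: "'a \<Rightarrow> ereal"
  assumes "prob_space M"
    and "\<sigma> > 0" and "n \<ge> 3" and "h = 1 / real n"
    and "\<forall>x. f x \<ge> 0" and "convex_on UNIV f" and "convergent_reciprocal_integral f"
    and "\<forall>i\<in>{2..n-1}. standard_brownian_motion M (w i)"
    and "independent_processes M {2..n-1} w"
    and "\<forall>i\<in>{2..n-1}. U0 i \<ge> 0"
    and "strong_solution M n h \<sigma> f w U0 U T"
  shows "\<P>(\<omega> in M. T \<omega> < \<infinity>) = 1"
proof -
  interpret prob_space M by fact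
  note solution = assms(11)[unfolded strong_solution_def]
  note lifetime = solution[THEN conjunct1, rule_format]
  note adapted = solution[THEN conjunct2, THEN conjunct1, rule_format]
  note dynamics = solution[THEN conjunct2, THEN conjunct2]
  let ?I = "{2..n-1}"
  have n: "3 \<le> n" and \<sigma>: "0 < \<sigma>" and h: "0 < h" using assms(2-4) by auto
  have nonneg: "\<And>x. 0 \<le> f x" and contf: "continuous_on UNIV f"
    using assms(5) convex_on_continuous[OF open_UNIV assms(6)] by auto
  obtain \<phi> l where l: "0 < l" and \<phi>: "\<And>i. i \<in> ?I \<Longrightarrow> 0 < \<phi> i" "(\<Sum>i\<in>?I. \<phi> i) = 1"
    and eigen: "\<And>u. u 1 = 0 \<Longrightarrow> u n = 0 \<Longrightarrow>
      (\<Sum>i\<in>?I. \<phi> i * (1 / h\<^sup>2 * (u (i + 1) - 2 * u i + u (i - 1)))) = - l * (\<Sum>i\<in>?I. \<phi> i * u i)"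
    by (rule ex_dirichlet_eigenvector[OF n h]) blast
  have "0 < 2 * l" using l by simp
  from ex_explosion_threshold[OF assms(6) nonneg assms(7) this] obtain x0 where x0: "0 < x0"
    "\<And>x. x0 \<le> x \<Longrightarrow> 0 < f x" "\<And>x. x0 \<le> x \<Longrightarrow> 2 * l * x \<le> f x"
    "\<And>x y. x0 \<le> x \<Longrightarrow> x \<le> y \<Longrightarrow> f x \<le> f y"
    "\<And>y. x0 \<le> y \<Longrightarrow> integral {x0..y} (\<lambda>s. 1 / f s) < 1/2" by blast

  have I: "finite ?I" "?I \<noteq> {}" using n by auto
  \<comment> \<open>Dividing by the Euclidean norm of the weights makes \<open>B\<close> a standard
    Brownian motion; the norm reappears in \<open>\<kappa>\<close>.\<close>
  define v where "v = sqrt (\<Sum>i\<in>?I. (\<phi> i)\<^sup>2)"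
  have v: "0 < v" unfolding v_def by (intro real_sqrt_gt_zero sum_pos zero_less_power I \<phi>(1))
  define \<kappa> where "\<kappa> = \<sigma> / sqrt h * v"
  have \<kappa>: "0 < \<kappa>" using \<sigma> h v by (simp add: \<kappa>_def)
  define B where "B t \<omega> = (\<Sum>i\<in>?I. \<phi> i / v * w i t \<omega>)" for t \<omega>
  have v2: "v\<^sup>2 = (\<Sum>i\<in>?I. (\<phi> i)\<^sup>2)" unfolding v_def by (intro real_sqrt_pow2 sum_nonneg) auto
  have "(\<Sum>i\<in>?I. (\<phi> i / v)\<^sup>2) = (\<Sum>i\<in>?I. (\<phi> i)\<^sup>2) / v\<^sup>2"
    by (simp add: power_divide sum_divide_distrib)
  also have "\<dots> = 1" unfolding v2[symmetric] using v by simp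
  finally have bm: "standard_brownian_motion M B"
    unfolding B_def[abs_def] using assms(8) \<phi>(1) v
    by (intro standard_brownian_motion_sum[OF I assms(9)]) auto
  have \<kappa>B: "(\<Sum>i\<in>?I. \<phi> i * (\<sigma> / sqrt h * w i t \<omega>)) = \<kappa> * B t \<omega>" for t \<omega>
    using v unfolding B_def \<kappa>_def sum_distrib_left by (intro sum.cong) auto

  define S where "S t \<omega> = (\<Sum>i\<in>?I. \<phi> i * U i t \<omega>)" for t \<omega>
  \<comment> \<open>Beyond the lifetime \<open>U\<close> carries no information, so the value 0 is
    substituted as in the adaptedness condition. On paths with
    \<open>T \<omega> = \<infinity>\<close> this agrees with \<open>S\<close>.\<close>
  define Y where "Y a \<omega> = (\<Sum>i\<in>?I. \<phi> i * (if ereal (real a) < T \<omega> then U i (real a) \<omega> else 0))" for a :: nat and \<omega>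
  have sub: "subalgebra M (augmented_filtration M ?I w t)" for t
    using assms(8) by (intro subalgebra_augmented_filtration) (auto simp: standard_brownian_motion_def)
  have Y: "Y a \<in> borel_measurable M" for a
    unfolding Y_def[abs_def]
  proof (intro borel_measurable_sum borel_measurable_times borel_measurable_const)
    fix i assume "i \<in> ?I"
    then have "i \<in> {1..n}" by auto
    then show "(\<lambda>\<omega>. if ereal (real a) < T \<omega> then U i (real a) \<omega> else 0) \<in> borel_measurable M"
      by (intro measurable_from_subalg[OF sub adapted]) auto
  qed
  \<comment> \<open>With this tolerance for \<open>B\<close>, the noise \<open>\<kappa> * B\<close>
    oscillates by at most 1 within a cell.\<close>
  have "0 < 1 / \<kappa>" using \<kappa> by simp
  from AE_ex_high_window[OF bm l this, of Y, OF Y] obtain r where r: "\<forall>R\<ge>0. AE \<omega> in M. \<exists>a L n. 0 < n \<and>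
      exp (- l * real L) * \<bar>Y a \<omega>\<bar> \<le> 1 \<and> high_window l R r a L n (\<lambda>j. mesh_increment B n j \<omega>) \<and>
      (\<forall>j<(a + L + 1) * n. \<forall>x\<in>{real j / n..real (Suc j) / n}. \<bar>B x \<omega> - B (real j / n) \<omega>\<bar> \<le> 1 / \<kappa>)" ..
  \<comment> \<open>The absolute value secures \<open>0 \<le> R\<close> whatever the sign of
    \<open>r\<close>.\<close>
  define R where "R = \<bar>x0 + l * x0 + \<kappa> * r + 3\<bar> / \<kappa>"
  have R: "0 \<le> R" "x0 + l * x0 + \<kappa> * r + 3 \<le> \<kappa> * R" using \<kappa> by (auto simp: R_def)

  have sol: "AE \<omega> in M. (\<forall>i\<in>{1..n}. continuous_on {t. 0 \<le> t \<and> ereal t < T \<omega>} (\<lambda>t. U i t \<omega>)) \<and>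
        (\<forall>t. 0 \<le> t \<and> ereal t < T \<omega> \<longrightarrow> U 1 t \<omega> = 0 \<and> U n t \<omega> = 0 \<and>
           (\<forall>i\<in>?I. U i t \<omega> = U0 i + integral {0..t} (\<lambda>s. drift h f (\<lambda>j. U j s \<omega>) i)
                        + \<sigma> / sqrt h * w i t \<omega>))"
    using dynamics by eventually_elim (elim conjE, intro conjI, assumption+)
  have "AE \<omega> in M. T \<omega> < \<infinity>"
    using sol r[rule_format, OF R(1)]
  proof eventually_elim
    case (elim \<omega>)
    show ?case
    proof (rule ccontr)
      assume "\<not> T \<omega> < \<infinity>"
      \<comment> \<open>An infinite lifetime would make the integral equations hold on all of
        \<open>{0..}\<close>, which a favourable window rules out.\<close>
      then have T: "T \<omega> = \<infinity>" by simp
      define F where "F t = (\<Sum>i\<in>?I. \<phi> i * f (U i t \<omega>))" for t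
      have "{t. 0 \<le> t \<and> ereal t < T \<omega>} = {0..}" using T by auto
      then have contU: "continuous_on {0..} (\<lambda>t. U i t \<omega>)" if "i \<in> {1..n}" for i
        using elim(1) that by auto
      have contU': "continuous_on A (\<lambda>t. U i t \<omega>)" if "i \<in> {1..n}" "A \<subseteq> {0..}" for i A
        using contU[OF that(1)] that(2) by (rule continuous_on_subset)
      have bdry: "U 1 t \<omega> = 0" "U n t \<omega> = 0" if "0 \<le> t" for t
        using elim(1) that T by auto
      have U: "U i t \<omega> = U0 i + integral {0..t} (\<lambda>s. drift h f (\<lambda>j. U j s \<omega>) i) + \<sigma> / sqrt h * w i t \<omega>"
        if "i \<in> ?I" "0 \<le> t" for i t
        using elim(1) that T by auto
      have contfU: "continuous_on A (\<lambda>t. f (U i t \<omega>))" if "i \<in> {1..n}" "A \<subseteq> {0..}" for i A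
        by (rule continuous_on_compose2[OF contf contU'[OF that]]) auto
      have contS: "continuous_on {0..} (\<lambda>t. S t \<omega>)" and contF: "continuous_on {0..} F"
        unfolding S_def F_def[abs_def] by (auto intro!: continuous_intros contU' contfU)
      have FS: "f (S t \<omega>) \<le> F t" for t
        unfolding S_def F_def using convex_on_sum[OF I(1) I(2) assms(6) \<phi>(2), of "\<lambda>i. U i t \<omega>"] \<phi>(1)
        by (auto simp: less_imp_le)
      have drift: "(\<Sum>i\<in>?I. \<phi> i * drift h f (\<lambda>j. U j s \<omega>) i) = F s - l * S s \<omega>" if "0 \<le> s" for s
        using eigen[of "\<lambda>j. U j s \<omega>"] bdry[OF that]
        by (simp add: drift_def F_def S_def distrib_left sum.distrib)
      have eq: "S t \<omega> = (\<Sum>i\<in>?I. \<phi> i * U0 i) + integral {0..t} (\<lambda>s. F s - l * S s \<omega>) + \<kappa> * B t \<omega>"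
        if t: "0 \<le> t" for t
      proof -
        have int: "(\<lambda>s. drift h f (\<lambda>j. U j s \<omega>) i) integrable_on {0..t}" if "i \<in> ?I" for i
        proof -
          have "i \<in> {1..n}" "i + 1 \<in> {1..n}" "i - 1 \<in> {1..n}" using that n by auto
          then show ?thesis unfolding drift_def
            by (intro integrable_continuous_real continuous_intros contU' contfU) auto
        qed
        have "S t \<omega> = (\<Sum>i\<in>?I. \<phi> i * U0 i) + (\<Sum>i\<in>?I. \<phi> i * integral {0..t} (\<lambda>s. drift h f (\<lambda>j. U j s \<omega>) i))
            + (\<Sum>i\<in>?I. \<phi> i * (\<sigma> / sqrt h * w i t \<omega>))"
          unfolding S_def using U[OF _ t] by (simp add: distrib_left sum.distrib)
        also have "(\<Sum>i\<in>?I. \<phi> i * integral {0..t} (\<lambda>s. drift h f (\<lambda>j. U j s \<omega>) i))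
            = integral {0..t} (\<lambda>s. \<Sum>i\<in>?I. \<phi> i * drift h f (\<lambda>j. U j s \<omega>) i)"
          using int by (subst integral_sum) (auto intro: integrable_on_mult_right)
        also have "\<dots> = integral {0..t} (\<lambda>s. F s - l * S s \<omega>)"
          by (intro Henstock_Kurzweil_Integration.integral_cong drift) auto
        finally show ?thesis by (simp only: \<kappa>B)
      qed
      obtain a L N where N: "0 < N" and decay: "exp (- l * real L) * \<bar>Y a \<omega>\<bar> \<le> 1"
        and win: "high_window l R r a L N (\<lambda>j. mesh_increment B N j \<omega>)"
        and osc: "\<And>j x. j < (a + L + 1) * N \<Longrightarrow> x \<in> {real j / N..real (Suc j) / N} \<Longrightarrow>
          \<bar>B x \<omega> - B (real j / N) \<omega>\<bar> \<le> 1 / \<kappa>"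
        using elim(2) by blast
      have "Y a \<omega> = S (real a) \<omega>" using T by (simp add: Y_def S_def)
      with decay have decay: "exp (- l * real L) * \<bar>S (real a) \<omega>\<bar> \<le> 1" by simp
      show False
        by (rule high_window_imp_no_solution[OF contf nonneg x0 l \<kappa> contS contF eq FS N decay
              win[unfolded mesh_increment_def] R(2) osc])
    qed
  qed
  moreover have "{\<omega>\<in>space M. T \<omega> < \<infinity>} \<in> sets M"
  proof -
    \<comment> \<open>The lifetime is finite exactly if it is exceeded or reached by some integer,
      so countably many of the events in the filtration suffice.\<close>
    have "{\<omega>\<in>space M. ereal (real k) < T \<omega>} \<in> sets M" for k :: nat
      using lifetime[of "real k"] sub[of "real k"] by (auto simp: subalgebra_def)
    then have "{\<omega>\<in>space M. \<exists>k::nat. \<not> ereal (real k) < T \<omega>} \<in> sets M"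
      by (intro sets.sets_Collect_countable_Ex sets.sets_Collect_neg)
    moreover have "(\<exists>k::nat. \<not> ereal (real k) < T \<omega>) \<longleftrightarrow> T \<omega> < \<infinity>" for \<omega>
    proof (cases "T \<omega>")
      case (real x)
      then show ?thesis using real_arch_simple[of x] by (auto simp: not_less)
    qed auto
    ultimately show ?thesis by simp
  qed
  ultimately show ?thesis by (simp add: prob_Collect_eq_1)
qed

end
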